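(* Let $M = \mathbb{H}^3/\Gamma$ be a hyperbolic 3-orbifold, where $\Gamma \subset PSL_2(\mathbb{C})$ is a finitely generated, non-elementary Kleinian group. Then the complex length spectrum $\mathcal{L}(M)$ is of unbounded multiplicity; that is, for every positive integer $n$ there is a complex length which is shared by at least $n$ distinct conjugacy classes of loxodromic elements of $\Gamma$.
   Context: A Kleinian group is a discrete subgroup of $PSL_2(\mathbb{C})$, acting on hyperbolic 3-space $\mathbb{H}^3$ by orientation-preserving isometries. An element $\gamma \in \Gamma$ is loxodromic if $\mathrm{tr}^2\gamma \notin [0,4]$ (this includes hyperbolic elements); the trace is well-defined up to sign. A loxodromic element $\gamma$ has a complex length $\ell_0(\gamma) = \ell + i\theta$, meaning that $\gamma$ translates by distance $\ell$ along its invariant axis in $\mathbb{H}^3$ and rotates by the angle $\theta$ about it; it is related to the trace by $\ell_0(\gamma) = 2\cosh^{-1}(\mathrm{tr}\,\gamma/2)$ (with $\ell>0$ and $\theta$ taken modulo $2\pi$). A complex length has multiplicity $n$ if it is shared by exactly $n$ conjugacy classes in $\Gamma$. The complex length spectrum $\mathcal{L}(M)$ is the set of complex lengths of loxodromic elements of $\Gamma$, counted with multiplicity. *)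

theory Defs
  imports "HOL-Analysis.Analysis" "HOL-Algebra.Generated_Groups"
begin

section \<open>The group PSL(2,C)\<close>

definition SL2C :: "(complex^2^2) monoid" where
  "SL2C = \<lparr>carrier = {A. det A = 1}, mult = (**), one = mat 1\<rparr>"

text \<open>The elements of \<open>PSL2C\<close> are the cosets \<open>{A, - A}\<close>.\<close>

definition PSL2C :: "(complex^2^2) set monoid" where
  "PSL2C = SL2C Mod {mat 1, - mat 1}"

text \<open>The quotient topology; a coset is a set of matrices, so the preimage of a set \<open>U\<close> of
  cosets under the projection is \<open>\<Union>U\<close>.\<close>

definition PSL2C_topology :: "(complex^2^2) set topology" where
  "PSL2C_topology = topology
     (\<lambda>U. U \<subseteq> carrier PSL2C \<and> openin (top_of_set (carrier SL2C)) (\<Union>U))"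

definition tr_sq :: "(complex^2^2) set \<Rightarrow> complex" where
  "tr_sq \<gamma> = the_elem ((\<lambda>A. (trace A)\<^sup>2) ` \<gamma>)"

section \<open>The action on hyperbolic space and its sphere at infinity\<close>

text \<open>The upper half-space model of hyperbolic 3-space.\<close>

definition H3 :: "(complex \<times> real) set" where
  "H3 = {(z, t). t > 0}"

text \<open>The Poincare extension of the Moebius transformation \<open>z \<mapsto> (a z + b) / (c z + d)\<close>.\<close>

definition poincare_ext :: "complex^2^2 \<Rightarrow> complex \<times> real \<Rightarrow> complex \<times> real" where
  "poincare_ext A = (\<lambda>(z, t).
     let a = A $ 1 $ 1; b = A $ 1 $ 2; c = A $ 2 $ 1; d = A $ 2 $ 2;
         N = (cmod (c * z + d))\<^sup>2 + (cmod c)\<^sup>2 * t\<^sup>2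
     in (((a * z + b) * cnj (c * z + d) + a * cnj c * (of_real t)\<^sup>2) / of_real N, t / N))"

text \<open>On the Riemann sphere, \<open>None\<close> is the point at infinity.\<close>

definition moebius :: "complex^2^2 \<Rightarrow> complex option \<Rightarrow> complex option" where
  "moebius A \<xi> =
     (let a = A $ 1 $ 1; b = A $ 1 $ 2; c = A $ 2 $ 1; d = A $ 2 $ 2
      in case \<xi> of
           None \<Rightarrow> if c = 0 then None else Some (a / c)
         | Some z \<Rightarrow> if c * z + d = 0 then None else Some ((a * z + b) / (c * z + d)))"

definition act_H3 :: "(complex^2^2) set \<Rightarrow> complex \<times> real \<Rightarrow> complex \<times> real" where
  "act_H3 \<gamma> p = the_elem ((\<lambda>A. poincare_ext A p) ` \<gamma>)"

definition act_sphere :: "(complex^2^2) set \<Rightarrow> complex option \<Rightarrow> complex option" where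
  "act_sphere \<gamma> \<xi> = the_elem ((\<lambda>A. moebius A \<xi>) ` \<gamma>)"

section \<open>Kleinian groups\<close>

definition kleinian :: "(complex^2^2) set set \<Rightarrow> bool" where
  "kleinian \<Gamma> \<longleftrightarrow> subgroup \<Gamma> PSL2C \<and>
     subtopology PSL2C_topology \<Gamma> = discrete_topology \<Gamma>"

definition fin_gen :: "(complex^2^2) set set \<Rightarrow> bool" where
  "fin_gen \<Gamma> \<longleftrightarrow> (\<exists>S. finite S \<and> S \<subseteq> carrier PSL2C \<and> \<Gamma> = generate PSL2C S)"

text \<open>A group is elementary if it has a finite orbit in hyperbolic space together with its
  sphere at infinity.\<close>

definition elementary :: "(complex^2^2) set set \<Rightarrow> bool" where
  "elementary \<Gamma> \<longleftrightarrow>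
     (\<exists>p\<in>H3. finite ((\<lambda>\<gamma>. act_H3 \<gamma> p) ` \<Gamma>)) \<or> (\<exists>\<xi>. finite ((\<lambda>\<gamma>. act_sphere \<gamma> \<xi>) ` \<Gamma>))"

section \<open>Loxodromic elements and complex length\<close>

definition loxodromic :: "(complex^2^2) set \<Rightarrow> bool" where
  "loxodromic \<gamma> \<longleftrightarrow> \<gamma> \<in> carrier PSL2C \<and> tr_sq \<gamma> \<notin> of_real ` {0..4}"

text \<open>The isometry translating by \<open>l\<close> along the geodesic from 0 to infinity (which is
  parametrised by arc length as \<open>s \<mapsto> (0, exp s)\<close>) and rotating by \<open>\<theta>\<close> about it.\<close>

definition screw :: "real \<Rightarrow> real \<Rightarrow> complex \<times> real \<Rightarrow> complex \<times> real" where
  "screw l \<theta> = (\<lambda>(z, t). (of_real (exp l) * cis \<theta> * z, exp l * t))"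

text \<open>The orientation-preserving isometry \<open>g\<close> carries the geodesic from 0 to infinity to the
  axis of \<open>\<gamma>\<close>, directed so that the translation length is positive.\<close>

definition has_complex_length :: "(complex^2^2) set \<Rightarrow> complex \<Rightarrow> bool" where
  "has_complex_length \<gamma> L \<longleftrightarrow> Re L > 0 \<and>
     (\<exists>g\<in>carrier PSL2C. \<forall>p\<in>H3. act_H3 \<gamma> (act_H3 g p) = act_H3 g (screw (Re L) (Im L) p))"

text \<open>The angle, which is only defined modulo \<open>2 * pi\<close>, is normalised to lie in
  \<open>{- pi<..pi}\<close>.\<close>

definition complex_length :: "(complex^2^2) set \<Rightarrow> complex" where
  "complex_length \<gamma> = (THE L. has_complex_length \<gamma> L \<and> Im L \<in> {- pi<..pi})"

definition conj_class :: "(complex^2^2) set set \<Rightarrow> (complex^2^2) set \<Rightarrow> (complex^2^2) set set" where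
  "conj_class \<Gamma> \<gamma> = (\<lambda>h. h \<otimes>\<^bsub>PSL2C\<^esub> \<gamma> \<otimes>\<^bsub>PSL2C\<^esub> inv\<^bsub>PSL2C\<^esub> h) ` \<Gamma>"

text \<open>The conjugacy classes of \<open>\<Gamma>\<close> that share the complex length \<open>L\<close>; their number is the
  multiplicity of \<open>L\<close> in the complex length spectrum.\<close>

definition classes_of_length :: "(complex^2^2) set set \<Rightarrow> complex \<Rightarrow> (complex^2^2) set set set" where
  "classes_of_length \<Gamma> L =
     conj_class \<Gamma> ` {\<gamma>\<in>\<Gamma>. loxodromic \<gamma> \<and> complex_length \<gamma> = L}"

section \<open>Well-definedness\<close>

lemma det_uminus_2: "det (- A) = det (A :: complex^2^2)"
  by (simp add: det_2)

lemma matrix_mul_uminus_left: "(- A) ** B = - (A ** (B :: complex^2^2))"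
  by (simp add: matrix_matrix_mult_def vec_eq_iff sum_negf)

lemma matrix_mul_uminus_right: "A ** (- B) = - (A ** (B :: complex^2^2))"
  by (simp add: matrix_matrix_mult_def vec_eq_iff sum_negf)

lemma SL2C_simps [simp]:
  "A \<in> carrier SL2C \<longleftrightarrow> det A = 1" "A \<otimes>\<^bsub>SL2C\<^esub> B = A ** B" "\<one>\<^bsub>SL2C\<^esub> = mat 1"
  by (auto simp: SL2C_def)

lemma SL2C_left_inverse:
  fixes A :: "complex^2^2" assumes "det A = 1" shows "\<exists>B. det B = 1 \<and> B ** A = mat 1"
proof -
  obtain B where B: "B ** A = mat 1"
    using assms by (metis invertible_def invertible_det_nz zero_neq_one)
  then have "det B * det A = 1" by (metis det_mul det_I)
  with assms B show ?thesis by auto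
qed

lemma group_SL2C: "group SL2C"
proof (rule groupI)
  show "\<exists>y\<in>carrier SL2C. y \<otimes>\<^bsub>SL2C\<^esub> x = \<one>\<^bsub>SL2C\<^esub>" if "x \<in> carrier SL2C" for x
    using that SL2C_left_inverse[of x] by (metis SL2C_simps)
qed (auto simp: det_mul matrix_mul_assoc)

lemma normal_pm1: "{mat 1, - mat 1} \<lhd> SL2C"
proof -
  interpret group SL2C by (rule group_SL2C)
  have inv_m1: "inv\<^bsub>SL2C\<^esub> (- mat 1) = - mat 1"
    by (rule inv_equality) (auto simp: matrix_mul_uminus_left matrix_mul_uminus_right det_uminus_2)
  have sub: "subgroup {mat 1, - mat 1} SL2C"
    using inv_m1 inv_one
    by unfold_locales (auto simp: matrix_mul_uminus_left matrix_mul_uminus_right det_uminus_2)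
  have "x ** h ** inv\<^bsub>SL2C\<^esub> x \<in> {mat 1, - mat 1}" if "det x = 1" "h \<in> {mat 1, - mat 1}" for x h
    using that r_inv[of x] by (auto simp: matrix_mul_uminus_left matrix_mul_uminus_right)
  then show ?thesis
    unfolding normal_inv_iff using sub by auto
qed

lemma group_PSL2C: "group PSL2C"
  unfolding PSL2C_def by (rule normal.factorgroup_is_group[OF normal_pm1])

lemma carrier_PSL2C: "carrier PSL2C = {{A, - A} |A. det A = 1}"
  by (auto simp: PSL2C_def FactGroup_def RCOSETS_def r_coset_def matrix_mul_uminus_left insert_commute)

lemma openin_PSL2C_topology:
  "openin PSL2C_topology U \<longleftrightarrow>
     U \<subseteq> carrier PSL2C \<and> openin (top_of_set (carrier SL2C)) (\<Union>U)"
proof -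
  have dis: "x = y" if "A \<in> x" "A \<in> y" "x \<in> carrier PSL2C" "y \<in> carrier PSL2C" for A x y
    using that by (auto simp: carrier_PSL2C)
  have int: "\<Union>(S \<inter> T) = \<Union>S \<inter> \<Union>T" if "S \<subseteq> carrier PSL2C" "T \<subseteq> carrier PSL2C" for S T
    using dis that by blast
  have un: "openin (top_of_set (carrier SL2C)) (\<Union>(\<Union>K))"
    if "\<forall>S\<in>K. S \<subseteq> carrier PSL2C \<and> openin (top_of_set (carrier SL2C)) (\<Union>S)" for K
  proof -
    have "\<Union>(\<Union>K) = \<Union>(Union ` K)" by blast
    with that show ?thesis by (metis (no_types, lifting) imageE openin_Union)
  qed
  have "istopology (\<lambda>U. U \<subseteq> carrier PSL2C \<and> openin (top_of_set (carrier SL2C)) (\<Union>U))"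
    unfolding istopology_def
    using int un by (intro conjI allI impI) (simp_all add: openin_Int le_infI1 Sup_le_iff)
  then show ?thesis
    unfolding PSL2C_topology_def by (simp add: topology_inverse')
qed

lemma trace_2: "trace (A :: complex^2^2) = A $ 1 $ 1 + A $ 2 $ 2"
  by (simp add: trace_def sum_2)

lemma tr_sq_coset [simp]: "tr_sq {A, - A} = (trace A)\<^sup>2"
  by (simp add: tr_sq_def trace_2 power2_eq_square algebra_simps)

lemma poincare_ext_uminus [simp]: "poincare_ext (- A) p = poincare_ext A p"
proof -
  have "cmod (- (c * z) - d) = cmod (c * z + d)" for c z d
    by (metis minus_add_distrib norm_minus_cancel diff_conv_add_uminus)
  then show ?thesis
    by (cases p) (simp add: poincare_ext_def Let_def algebra_simps)
qed

lemma moebius_uminus [simp]: "moebius (- A) \<xi> = moebius A \<xi>"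
proof -
  have "- (c * z) - d = 0 \<longleftrightarrow> c * z + d = 0" for c z d :: complex
    by (metis minus_add_distrib neg_equal_0_iff_equal diff_conv_add_uminus)
  moreover have "(- (a * z) - b) / (- (c * z) - d) = (a * z + b) / (c * z + d)" for a b c d z :: complex
    by (metis minus_add_distrib minus_divide_divide diff_conv_add_uminus)
  ultimately show ?thesis
    by (cases \<xi>) (auto simp: moebius_def Let_def)
qed

lemma act_H3_coset [simp]: "act_H3 {A, - A} p = poincare_ext A p"
  by (simp add: act_H3_def)

lemma act_sphere_coset [simp]: "act_sphere {A, - A} \<xi> = moebius A \<xi>"
  by (simp add: act_sphere_def)

lemma poincare_ext_eq:
  fixes A :: "complex^2^2"
  assumes "N = (A $ 2 $ 1 * z + A $ 2 $ 2) * cnj (A $ 2 $ 1 * z + A $ 2 $ 2)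
      + A $ 2 $ 1 * cnj (A $ 2 $ 1) * (of_real t)\<^sup>2"
  shows "fst (poincare_ext A (z, t)) = ((A $ 1 $ 1 * z + A $ 1 $ 2) * cnj (A $ 2 $ 1 * z + A $ 2 $ 2)
      + A $ 1 $ 1 * cnj (A $ 2 $ 1) * (of_real t)\<^sup>2) / N"
    and "of_real (snd (poincare_ext A (z, t))) = of_real t / N"
proof -
  have "of_real ((cmod (A $ 2 $ 1 * z + A $ 2 $ 2))\<^sup>2 + (cmod (A $ 2 $ 1))\<^sup>2 * t\<^sup>2) = N"
    unfolding assms
    by (simp only: of_real_add of_real_mult of_real_power complex_norm_square[symmetric])
  then show "fst (poincare_ext A (z, t)) = ((A $ 1 $ 1 * z + A $ 1 $ 2) * cnj (A $ 2 $ 1 * z + A $ 2 $ 2)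
      + A $ 1 $ 1 * cnj (A $ 2 $ 1) * (of_real t)\<^sup>2) / N"
    and "of_real (snd (poincare_ext A (z, t))) = of_real t / N"
    by (simp_all only: poincare_ext_def Let_def fst_conv snd_conv prod.case of_real_divide)
qed

lemma poincare_denom_pos:
  fixes A :: "complex^2^2"
  assumes "det A = 1" "t > 0"
  shows "(cmod (A $ 2 $ 1 * z + A $ 2 $ 2))\<^sup>2 + (cmod (A $ 2 $ 1))\<^sup>2 * t\<^sup>2 > 0"
proof (cases "A $ 2 $ 1 = 0")
  case True
  then have "A $ 2 $ 2 \<noteq> 0" using assms by (auto simp: det_2)
  then show ?thesis using True by simp
next
  case False
  then show ?thesis using assms by (intro add_nonneg_pos mult_pos_pos) auto
qed

lemma poincare_ext_H3:
  assumes "det A = 1" "p \<in> H3" shows "poincare_ext A p \<in> H3"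
  using assms poincare_denom_pos[OF assms(1)]
  by (cases p) (auto simp: H3_def poincare_ext_def Let_def)

lemma poincare_ext_mult_aux:
  fixes x y z t c d e f g h c' d' e' f' g' h' :: complex
  assumes "P = (e * z + f) * (g' * z' + h') + e * g' * t\<^sup>2"
    and "P' = (e' * z' + f') * (g * z + h) + e' * g * t\<^sup>2"
    and "M = (g * z + h) * (g' * z' + h') + g * g' * t\<^sup>2"
  shows "(x * P + y * M) * (c' * P' + d' * M)
       + x * c' * (e * h - f * g) * (e' * h' - f' * g') * t\<^sup>2
     = M * (((x * e + y * g) * z + (x * f + y * h)) * ((c' * e' + d' * g') * z' + (c' * f' + d' * h'))
         + (x * e + y * g) * (c' * e' + d' * g') * t\<^sup>2)"
  unfolding assms by (simp add: algebra_simps power2_eq_square)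

lemma poincare_ext_mult:
  assumes B: "det B = 1" and p: "p \<in> H3"
  shows "poincare_ext (A ** B) p = poincare_ext A (poincare_ext B p)"
proof -
  obtain z t where zt: "p = (z, t)" "t > 0" using p by (auto simp: H3_def)
  define T where "T = complex_of_real t"
  define a b c d where "a = A $ 1 $ 1" "b = A $ 1 $ 2" "c = A $ 2 $ 1" "d = A $ 2 $ 2"
  define e f g h where "e = B $ 1 $ 1" "f = B $ 1 $ 2" "g = B $ 2 $ 1" "h = B $ 2 $ 2"
  note defs = a_b_c_d_def e_f_g_h_def
  have det: "e * h - f * g = 1" using B by (simp add: det_2 defs)
  then have det': "cnj e * cnj h - cnj f * cnj g = 1"
    by (metis complex_cnj_diff complex_cnj_mult complex_cnj_one)
  define M where "M = (g * z + h) * cnj (g * z + h) + g * cnj g * T\<^sup>2"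
  define P where "P = (e * z + f) * cnj (g * z + h) + e * cnj g * T\<^sup>2"
  define w where "w = fst (poincare_ext B p)"
  define s where "s = snd (poincare_ext B p)"
  define K where "K = ((c * e + d * g) * z + (c * f + d * h)) * cnj ((c * e + d * g) * z + (c * f + d * h))
     + (c * e + d * g) * cnj (c * e + d * g) * T\<^sup>2"
  have ws: "w = P / M" "of_real s = T / M"
    unfolding w_def s_def zt(1) P_def
    by (simp_all only: poincare_ext_eq[of M B z t] M_def T_def defs)
  have cM: "cnj M = M" by (simp add: M_def T_def algebra_simps)
  have M: "M \<noteq> 0"
  proof -
    have "M = of_real ((cmod (g * z + h))\<^sup>2 + (cmod g)\<^sup>2 * t\<^sup>2)"
      by (simp only: M_def T_def of_real_add of_real_mult of_real_power complex_norm_square[symmetric])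
    moreover have "(cmod (g * z + h))\<^sup>2 + (cmod g)\<^sup>2 * t\<^sup>2 \<noteq> 0"
      using poincare_denom_pos[OF B zt(2), of z] by (simp add: defs)
    ultimately show ?thesis by (metis of_real_eq_0_iff)
  qed
  have AB: "(A ** B) $ 1 $ 1 = a * e + b * g" "(A ** B) $ 1 $ 2 = a * f + b * h"
    "(A ** B) $ 2 $ 1 = c * e + d * g" "(A ** B) $ 2 $ 2 = c * f + d * h"
    by (simp_all add: matrix_matrix_mult_def sum_2 defs)
  have id: "(x * P + y * M) * (cnj c * cnj P + cnj d * M)
       + x * cnj c * (e * h - f * g) * (cnj e * cnj h - cnj f * cnj g) * T\<^sup>2
     = M * (((x * e + y * g) * z + (x * f + y * h)) * cnj ((c * e + d * g) * z + (c * f + d * h))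
         + (x * e + y * g) * cnj (c * e + d * g) * T\<^sup>2)" for x y
    unfolding P_def M_def T_def complex_cnj_add complex_cnj_mult complex_cnj_power
      complex_cnj_complex_of_real complex_cnj_cnj
    by (rule poincare_ext_mult_aux) (rule refl)+
  have cancel: "X = Y / M" if "X * M\<^sup>2 = M * Y" "M \<noteq> 0" for X Y
    using that by (simp add: field_simps power2_eq_square)
  have id': "(x * w + y) * cnj (c * w + d) + x * cnj c * (of_real s)\<^sup>2
     = (((x * e + y * g) * z + (x * f + y * h)) * cnj ((c * e + d * g) * z + (c * f + d * h))
         + (x * e + y * g) * cnj (c * e + d * g) * T\<^sup>2) / M" for x y
  proof -
    have "((x * w + y) * cnj (c * w + d) + x * cnj c * (of_real s)\<^sup>2) * M\<^sup>2
      = (x * P + y * M) * (cnj c * cnj P + cnj d * M) + x * cnj c * T\<^sup>2"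
      using M by (simp add: ws cM field_simps power2_eq_square)
    also have "\<dots> = M * (((x * e + y * g) * z + (x * f + y * h)) * cnj ((c * e + d * g) * z + (c * f + d * h))
         + (x * e + y * g) * cnj (c * e + d * g) * T\<^sup>2)"
      using id[of x y] by (simp only: det det' mult_1_right)
    finally show ?thesis using M cancel by blast
  qed
  have quot: "(X / M) / (K / M) = X / K" for X
    using M by simp
  have fstsnd: "poincare_ext B p = (w, s)" by (simp add: w_def s_def)
  have K: "K / M = (c * w + d) * cnj (c * w + d) + c * cnj c * (of_real s)\<^sup>2"
    unfolding id' K_def ..
  have "fst (poincare_ext A (w, s)) = ((a * w + b) * cnj (c * w + d) + a * cnj c * (of_real s)\<^sup>2) / (K / M)"
    "of_real (snd (poincare_ext A (w, s))) = of_real s / (K / M)"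
    using poincare_ext_eq[of "K / M" A w s] K by (simp_all only: defs)
  moreover have "fst (poincare_ext (A ** B) (z, t)) =
      (((a * e + b * g) * z + (a * f + b * h)) * cnj ((c * e + d * g) * z + (c * f + d * h))
         + (a * e + b * g) * cnj (c * e + d * g) * T\<^sup>2) / K"
    "of_real (snd (poincare_ext (A ** B) (z, t))) = T / K"
    using poincare_ext_eq[of K "A ** B" z t] by (simp_all only: AB K_def T_def)
  ultimately have "fst (poincare_ext (A ** B) (z, t)) = fst (poincare_ext A (w, s))"
    "complex_of_real (snd (poincare_ext (A ** B) (z, t))) = of_real (snd (poincare_ext A (w, s)))"
    using quot by (simp_all only: id'[unfolded ws(2)] ws(2))
  then show ?thesis
    by (simp only: fstsnd[unfolded zt(1)] zt(1) prod_eq_iff fst_conv snd_conv of_real_eq_iff)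
qed

definition diag_exp :: "complex \<Rightarrow> complex^2^2" where
  "diag_exp L = vector [vector [exp (L / 2), 0], vector [0, exp (- L / 2)]]"

lemma diag_exp_entries [simp]:
  "diag_exp L $ 1 $ 1 = exp (L / 2)" "diag_exp L $ 1 $ 2 = 0"
  "diag_exp L $ 2 $ 1 = 0" "diag_exp L $ 2 $ 2 = exp (- L / 2)"
  by (simp_all add: diag_exp_def)

lemma det_diag_exp [simp]: "det (diag_exp L) = 1"
  by (simp add: det_2 flip: exp_add)

lemma screw_eq: "poincare_ext (diag_exp L) p = screw (Re L) (Im L) p"
proof -
  have 1: "exp (L / 2) * cnj (exp (- (L / 2))) / of_real ((cmod (exp (- (L / 2))))\<^sup>2) = exp L"
  proof -
    have "exp (L / 2) * cnj (exp (- (L / 2))) / (exp (- (L / 2)) * cnj (exp (- (L / 2))))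
        = exp (L / 2) / exp (- (L / 2))" by simp
    also have "\<dots> = exp L" by (simp flip: exp_diff)
    finally show ?thesis unfolding complex_norm_square .
  qed
  have 2: "(cmod (exp (- (L / 2))))\<^sup>2 = exp (- Re L)"
    by (simp add: power2_eq_square flip: exp_add)
  have 3: "of_real (exp (Re L)) * cis (Im L) = exp L" by (simp add: exp_eq_polar)
  show ?thesis
  proof (cases p)
    case (Pair z t)
    have "exp (L / 2) * z * cnj (exp (- (L / 2))) / of_real ((cmod (exp (- (L / 2))))\<^sup>2)
       = exp L * z" using 1 by (metis mult.assoc mult.commute times_divide_eq_left)
    moreover have "fst (poincare_ext (diag_exp L) (z, t)) =
        exp (L / 2) * z * cnj (exp (- (L / 2))) / of_real ((cmod (exp (- (L / 2))))\<^sup>2)"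
      by (simp add: poincare_ext_def Let_def)
    moreover have "snd (poincare_ext (diag_exp L) (z, t)) = t / (cmod (exp (- (L / 2))))\<^sup>2"
      by (simp add: poincare_ext_def Let_def)
    moreover have "t / (cmod (exp (- (L / 2))))\<^sup>2 = exp (Re L) * t"
      unfolding 2 by (simp add: exp_minus divide_inverse mult.commute)
    ultimately show ?thesis
      unfolding Pair screw_def prod.case 3 by (simp only: prod_eq_iff fst_conv snd_conv)
  qed
qed

lemma cosh_sq: "4 * (cosh (L / 2))\<^sup>2 = exp L + 2 + exp (- L)" for L :: complex
proof -
  have "exp (L/2) * exp (L/2) = exp L" "exp (-(L/2)) * exp (-(L/2)) = exp (-L)"
    "exp (L/2) * exp (-(L/2)) = 1"
    by (simp_all flip: exp_add)
  moreover have "4 * (cosh (L / 2))\<^sup>2 = (exp (L/2) + exp (-(L/2)))\<^sup>2"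
    by (simp add: cosh_def scaleR_conv_of_real power2_eq_square)
  ultimately show ?thesis by (simp add: power2_eq_square algebra_simps)
qed

lemma trace_conj_SL2C:
  fixes A G H :: "complex^2^2" assumes "H ** G = mat 1" shows "trace (H ** (A ** G)) = trace A"
  by (metis assms matrix_left_right_inverse matrix_mul_assoc matrix_mul_rid trace_mul_sym)

lemma trace_of_screw:
  fixes N :: "complex^2^2"
  assumes det: "det N = 1" and eq: "\<And>p. p \<in> H3 \<Longrightarrow> poincare_ext N p = screw l \<theta> p"
  shows "(trace N)\<^sup>2 = 4 * (cosh (Complex l \<theta> / 2))\<^sup>2"
proof -
  define a b c d where "a = N $ 1 $ 1" "b = N $ 1 $ 2" "c = N $ 2 $ 1" "d = N $ 2 $ 2"
  note defs = a_b_c_d_def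
  have ht: "(cmod d)\<^sup>2 + (cmod c)\<^sup>2 * t\<^sup>2 = exp (- l)" if "t > 0" for t
  proof -
    define M where "M = (cmod d)\<^sup>2 + (cmod c)\<^sup>2 * t\<^sup>2"
    have "M > 0" using poincare_denom_pos[OF det that, of 0] by (simp add: M_def defs)
    moreover have "t / M = exp l * t"
      using arg_cong[OF eq[of "(0, t)"], of snd] that
      by (simp add: H3_def poincare_ext_def screw_def Let_def defs M_def)
    ultimately have "M = exp (- l)" using that by (simp add: exp_minus field_simps)
    then show ?thesis by (simp add: M_def)
  qed
  have "(cmod c)\<^sup>2 * 1\<^sup>2 = (cmod c)\<^sup>2 * 2\<^sup>2" using ht[of 1] ht[of 2] by linarith
  then have c: "c = 0" by simp
  with det have ad: "a * d = 1" by (simp add: det_2 defs)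
  have b: "b = 0"
    using eq[of "(0, 1)"] c ad by (auto simp: H3_def poincare_ext_def screw_def Let_def defs)
  have "a * cnj d / of_real ((cmod d)\<^sup>2) = of_real (exp l) * cis \<theta>"
    using eq[of "(1, 1)"] c b by (auto simp: H3_def poincare_ext_def screw_def Let_def defs)
  then have "a * cnj d / (d * cnj d) = exp (Complex l \<theta>)"
    unfolding complex_norm_square by (simp add: exp_eq_polar)
  moreover have "d \<noteq> 0" using ad by auto
  ultimately have "a / d = exp (Complex l \<theta>)" by simp
  moreover have "a \<noteq> 0" using ad by auto
  ultimately have a2: "a * a = exp (Complex l \<theta>)"
    using ad by (metis nonzero_eq_divide_eq mult.assoc mult.commute mult_1_right \<open>d \<noteq> 0\<close>)
  have "(a * a) * (d * d) = (a * d) * (a * d)" by (simp only: ac_simps)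
  then have "exp (Complex l \<theta>) * (d * d) = 1" by (simp add: a2 ad)
  then have d2: "d * d = exp (- Complex l \<theta>)"
    unfolding exp_minus by (rule inverse_unique[symmetric])
  have "(trace N)\<^sup>2 = a * a + 2 * (a * d) + d * d"
    by (simp add: trace_2 defs power2_eq_square algebra_simps)
  then show ?thesis by (simp add: a2 d2 ad cosh_sq)
qed

lemma has_complex_length_trace:
  assumes \<gamma>: "\<gamma> \<in> carrier PSL2C" and L: "has_complex_length \<gamma> L"
  shows "tr_sq \<gamma> = 4 * (cosh (L / 2))\<^sup>2"
proof -
  obtain A where A: "\<gamma> = {A, - A}" "det A = 1" using \<gamma> by (auto simp: carrier_PSL2C)
  obtain G where G: "det G = 1"
    "\<And>p. p \<in> H3 \<Longrightarrow> poincare_ext A (poincare_ext G p) = poincare_ext G (screw (Re L) (Im L) p)"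
    using L A by (auto simp: has_complex_length_def carrier_PSL2C)
  obtain H where H: "det H = 1" "H ** G = mat 1" using SL2C_left_inverse[OF G(1)] by blast
  have one: "poincare_ext (mat 1) p = p" for p
    by (cases p) (simp add: poincare_ext_def mat_def Let_def)
  have det: "det (H ** (A ** G)) = 1" by (simp add: det_mul A G H)
  have "poincare_ext (H ** (A ** G)) p = screw (Re L) (Im L) p" if p: "p \<in> H3" for p
  proof -
    have q: "screw (Re L) (Im L) p \<in> H3" using p by (auto simp: screw_def H3_def)
    have "poincare_ext (H ** (A ** G)) p = poincare_ext H (poincare_ext G (screw (Re L) (Im L) p))"
      using p G A by (simp add: poincare_ext_mult det_mul)
    also have "\<dots> = screw (Re L) (Im L) p"
      using poincare_ext_mult[OF G(1) q, of H] by (simp add: H one)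
    finally show ?thesis .
  qed
  from trace_of_screw[OF det this] show ?thesis
    by (simp add: A trace_conj_SL2C[OF H(2)])
qed

lemma cosh_sq_inject:
  assumes "cosh (L / 2) ^ 2 = cosh (L' / 2) ^ 2" "Re L > 0" "Re L' > 0"
  shows "exp L = exp (L' :: complex)"
proof -
  have "exp L + exp (- L) = exp L' + exp (- L')"
    using assms(1) cosh_sq[of L] cosh_sq[of L'] by (metis add.commute add.left_commute add_left_cancel)
  then have "(exp L - exp L') * (exp L * exp L' - 1) = 0"
    by (simp add: exp_minus field_simps)
  moreover have "exp L * exp L' \<noteq> 1"
  proof
    assume "exp L * exp L' = 1"
    then have "exp (Re L) * exp (Re L') = 1" by (metis norm_exp_eq_Re norm_mult norm_one)
    with assms show False by (simp flip: exp_add)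
  qed
  ultimately show ?thesis by simp
qed

lemma eigenvector_exists:
  fixes A :: "complex^2^2"
  assumes "x\<^sup>2 - trace A * x + det A = 0"
  shows "\<exists>v1 v2. (v1 \<noteq> 0 \<or> v2 \<noteq> 0) \<and>
     A $ 1 $ 1 * v1 + A $ 1 $ 2 * v2 = x * v1 \<and> A $ 2 $ 1 * v1 + A $ 2 $ 2 * v2 = x * v2"
proof -
  define a b c d where "a = A $ 1 $ 1" "b = A $ 1 $ 2" "c = A $ 2 $ 1" "d = A $ 2 $ 2"
  have eq: "x * x - (a + d) * x + (a * d - b * c) = 0"
    using assms by (simp add: a_b_c_d_def det_2 trace_2 power2_eq_square)
  consider "c \<noteq> 0" | "b \<noteq> 0" | "b = 0" "c = 0" "x = a" | "b = 0" "c = 0" "x = d"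
  proof -
    have "x = a \<or> x = d" if "b = 0" "c = 0"
    proof -
      have "(x - a) * (x - d) = 0" using eq that by (simp add: algebra_simps)
      then show ?thesis by simp
    qed
    then show ?thesis using that by blast
  qed
  then show ?thesis
    unfolding a_b_c_d_def[symmetric]
  proof cases
    case 1
    have "a * (x - d) + b * c = x * (x - d)" using eq by algebra
    with 1 show "\<exists>v1 v2. (v1 \<noteq> 0 \<or> v2 \<noteq> 0) \<and> a * v1 + b * v2 = x * v1 \<and> c * v1 + d * v2 = x * v2"
      by (intro exI[of _ "x - d"] exI[of _ c]) (simp add: algebra_simps)
  next
    case 2
    have "c * b + d * (x - a) = x * (x - a)" using eq by algebra
    with 2 show "\<exists>v1 v2. (v1 \<noteq> 0 \<or> v2 \<noteq> 0) \<and> a * v1 + b * v2 = x * v1 \<and> c * v1 + d * v2 = x * v2"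
      by (intro exI[of _ b] exI[of _ "x - a"]) (simp add: algebra_simps)
  next
    case 3
    then show "\<exists>v1 v2. (v1 \<noteq> 0 \<or> v2 \<noteq> 0) \<and> a * v1 + b * v2 = x * v1 \<and> c * v1 + d * v2 = x * v2"
      by (intro exI[of _ 1] exI[of _ 0]) simp
  next
    case 4
    then show "\<exists>v1 v2. (v1 \<noteq> 0 \<or> v2 \<noteq> 0) \<and> a * v1 + b * v2 = x * v1 \<and> c * v1 + d * v2 = x * v2"
      by (intro exI[of _ 0] exI[of _ 1]) simp
  qed
qed

lemma diagonalise_SL2C:
  fixes A :: "complex^2^2"
  assumes det: "det A = 1" and tr: "trace A = exp (L / 2) + exp (- L / 2)" and L: "Re L > 0"
  shows "\<exists>G. det G = 1 \<and> A ** G = G ** diag_exp L"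
proof -
  define x y where "x = exp (L / 2)" "y = exp (- L / 2)"
  note xy_def = x_y_def
  have xy: "x * y = 1" by (simp add: xy_def flip: exp_add)
  have ne: "x \<noteq> y"
  proof
    assume "x = y"
    then have "cmod x = cmod y" by simp
    with L show False by (simp add: xy_def)
  qed
  have "x\<^sup>2 - trace A * x + det A = 0" "y\<^sup>2 - trace A * y + det A = 0"
    using xy unfolding det tr xy_def[symmetric] by (algebra, algebra)
  then obtain v1 v2 w1 w2 where
    v: "v1 \<noteq> 0 \<or> v2 \<noteq> 0" "A $ 1 $ 1 * v1 + A $ 1 $ 2 * v2 = x * v1" "A $ 2 $ 1 * v1 + A $ 2 $ 2 * v2 = x * v2" and
    w: "w1 \<noteq> 0 \<or> w2 \<noteq> 0" "A $ 1 $ 1 * w1 + A $ 1 $ 2 * w2 = y * w1" "A $ 2 $ 1 * w1 + A $ 2 $ 2 * w2 = y * w2"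
    using eigenvector_exists by meson
  define k where "k = v1 * w2 - v2 * w1"
  have k: "k \<noteq> 0"
  proof
    assume k0: "k = 0"
    have "(x - y) * (v1 * w1) = (x * v1) * w1 - v1 * (y * w1)" by (simp add: algebra_simps)
    also have "\<dots> = - A $ 1 $ 2 * k" unfolding v(2)[symmetric] w(2)[symmetric] k_def
      by (simp add: algebra_simps)
    finally have "v1 * w1 = 0" using k0 ne by simp
    moreover have "(x - y) * (v2 * w2) = (x * v2) * w2 - v2 * (y * w2)" by (simp add: algebra_simps)
    then have "(x - y) * (v2 * w2) = A $ 2 $ 1 * k"
      unfolding v(3)[symmetric] w(3)[symmetric] k_def by (simp add: algebra_simps)
    then have "v2 * w2 = 0" using k0 ne by simp
    moreover have "v1 * w2 = v2 * w1" using k0 by (simp add: k_def)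
    ultimately show False using v(1) w(1) by auto
  qed
  define G :: "complex^2^2" where "G = vector [vector [v1 / k, w1], vector [v2 / k, w2]]"
  have "det G = v1 / k * w2 - w1 * (v2 / k)" by (simp add: G_def det_2)
  also have "\<dots> = k / k" unfolding k_def by (simp only: diff_divide_distrib times_divide_eq_left times_divide_eq_right mult.commute)
  finally have "det G = k / k" .
  then have "det G = 1" using k by simp
  moreover have "A ** G = G ** diag_exp L"
  proof -
    have "(A $ 1 $ 1 * v1 + A $ 1 $ 2 * v2) / k = x * v1 / k"
      "(A $ 2 $ 1 * v1 + A $ 2 $ 2 * v2) / k = x * v2 / k" using v by simp_all
    with w show ?thesis
      by (simp add: vec_eq_iff forall_2 matrix_matrix_mult_def sum_2 G_def xy_def
          add_divide_distrib mult.commute)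
  qed
  ultimately show ?thesis by blast
qed

text \<open>The relation \<open>L = 2 arcosh (tr / 2)\<close> between complex length and trace; in particular
  the definite description in \<open>complex_length\<close> is proper on loxodromic elements.\<close>

lemma has_complex_length_iff:
  assumes "\<gamma> \<in> carrier PSL2C"
  shows "has_complex_length \<gamma> L \<longleftrightarrow> Re L > 0 \<and> tr_sq \<gamma> = 4 * (cosh (L / 2))\<^sup>2"
proof safe
  assume R: "Re L > 0" and tr: "tr_sq \<gamma> = 4 * (cosh (L / 2))\<^sup>2"
  obtain A where A: "\<gamma> = {A, - A}" "det A = 1" using assms by (auto simp: carrier_PSL2C)
  have "(trace A)\<^sup>2 = (2 * cosh (L / 2))\<^sup>2" using tr A by (simp add: power2_eq_square)
  then have *: "trace A = 2 * cosh (L / 2) \<or> trace A = - (2 * cosh (L / 2))"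
    by (simp only: power2_eq_iff)
  have c: "2 * cosh (L / 2) = exp (L / 2) + exp (- L / 2)"
    by (simp add: cosh_def scaleR_conv_of_real)
  obtain B where B: "\<gamma> = {B, - B}" "det B = 1" "trace B = exp (L / 2) + exp (- L / 2)"
    using *
  proof
    assume "trace A = 2 * cosh (L / 2)"
    then show ?thesis using that[of A] A c by simp
  next
    assume "trace A = - (2 * cosh (L / 2))"
    moreover have "trace (- A) = - trace A" by (simp add: trace_2)
    ultimately show ?thesis using that[of "- A"] A c by (simp add: det_uminus_2 insert_commute)
  qed
  obtain G where G: "det G = 1" "B ** G = G ** diag_exp L"
    using diagonalise_SL2C[OF B(2,3) R] by blast
  have "\<forall>p\<in>H3. act_H3 \<gamma> (act_H3 {G, - G} p) = act_H3 {G, - G} (screw (Re L) (Im L) p)"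
  proof
    fix p assume p: "p \<in> H3"
    show "act_H3 \<gamma> (act_H3 {G, - G} p) = act_H3 {G, - G} (screw (Re L) (Im L) p)"
      unfolding B(1) act_H3_coset screw_eq[symmetric]
      using poincare_ext_mult[OF G(1) p, of B] poincare_ext_mult[OF det_diag_exp p, of G L] G(2) by simp
  qed
  with R G(1) show "has_complex_length \<gamma> L"
    unfolding has_complex_length_def carrier_PSL2C by blast
qed (use has_complex_length_trace[OF assms] in \<open>auto simp: has_complex_length_def\<close>)

lemma ex_has_complex_length:
  assumes "loxodromic \<gamma>"
  shows "\<exists>L. has_complex_length \<gamma> L \<and> Im L \<in> {- pi<..pi}"
proof -
  have \<gamma>: "\<gamma> \<in> carrier PSL2C" and tr: "tr_sq \<gamma> \<notin> of_real ` {0..4}"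
    using assms by (auto simp: loxodromic_def)
  define u where "u = (tr_sq \<gamma> - 2) / 2"
  define x where "x = u + csqrt (u\<^sup>2 - 1)"
  define y where "y = u - csqrt (u\<^sup>2 - 1)"
  have "x * y = u\<^sup>2 - (csqrt (u\<^sup>2 - 1))\<^sup>2"
    unfolding x_def y_def by (simp only: power2_eq_square algebra_simps)
  then have xy: "x * y = 1" by (simp only: power2_csqrt) simp
  have sum: "x + y = tr_sq \<gamma> - 2" by (simp add: x_def y_def u_def)
  have nx: "cmod x \<noteq> 1"
  proof
    assume n: "cmod x = 1"
    then have "x * cnj x = 1" by (simp flip: complex_norm_square)
    with xy have "x * y = x * cnj x" by simp
    moreover have "x \<noteq> 0" using n by auto
    ultimately have "y = cnj x" by simp
    then have "tr_sq \<gamma> = of_real (2 + 2 * Re x)"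
      using sum by (simp add: complex_eq_iff)
    moreover have "\<bar>Re x\<bar> \<le> 1" using abs_Re_le_cmod[of x] n by simp
    then have "2 + 2 * Re x \<in> {0..4}" by auto
    ultimately show False using tr by (metis image_eqI)
  qed
  obtain w where w: "cmod w > 1" "w + 1 / w = tr_sq \<gamma> - 2"
  proof (cases "cmod x > 1")
    case True
    moreover have "1 / x = y" using xy True by (metis nonzero_mult_div_cancel_left mult_zero_left zero_neq_one)
    ultimately show ?thesis using that[of x] sum by simp
  next
    case False
    have "cmod x * cmod y = 1" using xy by (metis norm_mult norm_one)
    moreover have "cmod x * cmod y < 1" if "cmod y \<le> 1"
      using mult_left_le[OF that norm_ge_zero[of x]] False nx by linarith
    ultimately have "cmod y > 1" by force
    moreover have "1 / y = x" using xy by (metis nonzero_mult_div_cancel_right mult_zero_right zero_neq_one)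
    ultimately show ?thesis using that[of y] sum by (simp add: add.commute)
  qed
  have w0: "w \<noteq> 0" using w by auto
  have "tr_sq \<gamma> = 4 * (cosh (Ln w / 2))\<^sup>2"
    unfolding cosh_sq exp_minus exp_Ln[OF w0] using w(2) by (simp add: divide_inverse algebra_simps)
  moreover have "Re (Ln w) > 0" using w w0 by simp
  ultimately show ?thesis
    using has_complex_length_iff[OF \<gamma>] w0 mpi_less_Im_Ln Im_Ln_le_pi
    by (intro exI[of _ "Ln w"]) auto
qed

lemma has_complex_length_unique:
  assumes "\<gamma> \<in> carrier PSL2C"
    "has_complex_length \<gamma> L" "Im L \<in> {- pi<..pi}" "has_complex_length \<gamma> L'" "Im L' \<in> {- pi<..pi}"
  shows "L = L'"
proof -
  have "exp L = exp L'"
    using assms(2,4) unfolding has_complex_length_iff[OF assms(1)] by (intro cosh_sq_inject) auto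
  with assms(3,5) show ?thesis by (metis Ln_exp greaterThanAtMost_iff)
qed

lemma complex_length_eq_iff:
  assumes "loxodromic \<gamma>"
  shows "complex_length \<gamma> = L \<longleftrightarrow>
    Re L > 0 \<and> Im L \<in> {- pi<..pi} \<and> tr_sq \<gamma> = 4 * (cosh (L / 2))\<^sup>2"
proof -
  have \<gamma>: "\<gamma> \<in> carrier PSL2C" using assms by (simp add: loxodromic_def)
  have ex1: "\<exists>!L. has_complex_length \<gamma> L \<and> Im L \<in> {- pi<..pi}"
    using ex_has_complex_length[OF assms] has_complex_length_unique[OF \<gamma>] by (intro ex_ex1I) auto
  have "complex_length \<gamma> = L \<longleftrightarrow> has_complex_length \<gamma> L \<and> Im L \<in> {- pi<..pi}"
    unfolding complex_length_def using theI'[OF ex1] the1_equality[OF ex1, of L] by auto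
  then show ?thesis by (auto simp: has_complex_length_iff[OF \<gamma>])
qed

end

theory Submission
  imports Defs
begin

text \<open>Let \<open>H\<close> be the preimage of \<open>\<Gamma>\<close> in SL(2,C). The complex length of a loxodromic element depends only on
  its trace, so for every \<open>n\<close> it suffices to find \<open>n\<close> elements of \<open>H\<close> with the same trace, of modulus greater
  than 2, no two of which are conjugate in \<open>H\<close> up to sign.

  First, \<open>H\<close> contains an element with trace of modulus greater than 2 (\<open>exists_trace_gt_2\<close>). Suppose not.
  If some element has two distinct eigenvalues, then bounded traces force all entries to be bounded, and
  \<open>H\<close> is finite by discreteness; otherwise there is a parabolic element, and bounded traces force its
  fixed point to be fixed by all of \<open>H\<close>. Both are impossible in a non-elementary group. After a
  conjugation, \<open>b = diag(x, 1/x)\<close> with \<open>\<bar>x\<bar> > 1\<close> belongs to \<open>H\<close>.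

  If two elements \<open>u\<close> and \<open>v\<close> of \<open>H\<close> have the same diagonal entries, then \<open>u b\<^sup>M\<close> and \<open>v b\<^sup>M\<close>
  have the same trace for every \<open>M\<close>. When are they conjugate in \<open>H\<close>? Geometrically, the axis of \<open>u b\<^sup>M\<close>
  runs for a long time close to the axis of \<open>b\<close>, so a conjugator must, up to powers of \<open>b\<close>, lie in a compact
  region that does not depend on \<open>M\<close>. By discreteness the same element occurs for infinitely many \<open>M\<close>,
  and in the limit it fixes an end of the axis of \<open>b\<close>, hence both ends. Thus conjugacy for
  infinitely many \<open>M\<close> is possible only if \<open>u\<close> and \<open>v\<close> are conjugate by a diagonal element
  \<open>diag(a, 1/a)\<close> of \<open>H\<close>, so that their lower left entries differ by the factor \<open>a\<^sup>2\<close>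
  (\<open>conjugate_translates\<close>). By discreteness, \<open>a\<^sup>2\<close> is either equal to 1 or bounded away from 1.

  It remains to produce \<open>n\<close> elements of \<open>H\<close> with the same diagonal whose lower left entries are distinct but
  have ratios close to 1 (\<open>equal_diagonals\<close>). They come from the classical source of equal traces in
  SL(2,C), the reversal of words: \<open>u b\<^sup>l\<^sup>+\<^sup>1 u b\<^sup>l u\<close> and \<open>u b\<^sup>l u b\<^sup>l\<^sup>+\<^sup>1 u\<close> have the same diagonal, and the ratio
  of their lower left entries differs from 1 and tends to 1 as \<open>l\<close> grows. For all large \<open>M\<close> the
  products of these elements with \<open>b\<^sup>M\<close> are then pairwise non-conjugate.\<close>

section \<open>Two by two matrices\<close>

definition mat2 :: "complex \<Rightarrow> complex \<Rightarrow> complex \<Rightarrow> complex \<Rightarrow> complex^2^2" where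
  "mat2 a b c d = vector [vector [a, b], vector [c, d]]"

lemma mat2_entries [simp]:
  "mat2 a b c d $ 1 $ 1 = a" "mat2 a b c d $ 1 $ 2 = b"
  "mat2 a b c d $ 2 $ 1 = c" "mat2 a b c d $ 2 $ 2 = d"
  by (simp_all add: mat2_def)

lemma mat2_collapse: "mat2 (A $ 1 $ 1) (A $ 1 $ 2) (A $ 2 $ 1) (A $ 2 $ 2) = A"
  by (simp add: vec_eq_iff forall_2)

lemma mat2_eq_iff [simp]:
  "mat2 a b c d = mat2 a' b' c' d' \<longleftrightarrow> a = a' \<and> b = b' \<and> c = c' \<and> d = d'"
  by (metis mat2_entries)

lemma mat2_mult [simp]:
  "mat2 a b c d ** mat2 a' b' c' d' =
     mat2 (a * a' + b * c') (a * b' + b * d') (c * a' + d * c') (c * b' + d * d')"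
  by (simp add: vec_eq_iff forall_2 matrix_matrix_mult_def sum_2)

lemma det_mat2 [simp]: "det (mat2 a b c d) = a * d - b * c"
  by (simp add: det_2)

lemma trace_mat2 [simp]: "trace (mat2 a b c d) = a + d"
  by (simp add: trace_2)

lemma uminus_mat2 [simp]: "- mat2 a b c d = mat2 (- a) (- b) (- c) (- d)"
  by (simp add: vec_eq_iff forall_2)

lemma mat_1_mat2: "mat 1 = mat2 1 0 0 1"
  by (simp add: vec_eq_iff forall_2 mat_def)

text \<open>On matrices of determinant one the adjugate is the inverse.\<close>

definition adj2 :: "complex^2^2 \<Rightarrow> complex^2^2" where
  "adj2 A = mat2 (A $ 2 $ 2) (- A $ 1 $ 2) (- A $ 2 $ 1) (A $ 1 $ 1)"

lemma adj2_mat2 [simp]: "adj2 (mat2 a b c d) = mat2 d (- b) (- c) a"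
  by (simp add: adj2_def)

lemma mat2_cases: obtains a b c d where "A = mat2 a b c d"
  by (metis mat2_collapse)

lemma adj2_inverse:
  assumes "det A = 1"
  shows "A ** adj2 A = mat 1" "adj2 A ** A = mat 1"
  using assms by (cases A rule: mat2_cases, simp add: mat_1_mat2 algebra_simps)+

lemma adj2_mult: "adj2 (A ** B) = adj2 B ** adj2 A"
  by (cases A rule: mat2_cases, cases B rule: mat2_cases) (simp add: algebra_simps)

lemma adj2_adj2 [simp]: "adj2 (adj2 A) = A"
  by (cases A rule: mat2_cases) simp

lemma det_adj2 [simp]: "det (adj2 A) = det A"
  by (cases A rule: mat2_cases) (simp add: algebra_simps)

lemma bounded_mat2:
  "bounded {A :: complex^2^2. cmod (A $ 1 $ 1) \<le> K \<and> cmod (A $ 1 $ 2) \<le> K \<and>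
     cmod (A $ 2 $ 1) \<le> K \<and> cmod (A $ 2 $ 2) \<le> K}"
proof (rule boundedI)
  fix A :: "complex^2^2"
  assume A: "A \<in> {A. cmod (A $ 1 $ 1) \<le> K \<and> cmod (A $ 1 $ 2) \<le> K \<and>
     cmod (A $ 2 $ 1) \<le> K \<and> cmod (A $ 2 $ 2) \<le> K}"
  have row: "norm (A $ i) \<le> cmod (A $ i $ 1) + cmod (A $ i $ 2)" for i
    using L2_set_le_sum[of UNIV "\<lambda>j. cmod (A $ i $ j)"] by (simp add: norm_vec_def sum_2)
  have "norm A \<le> norm (A $ 1) + norm (A $ 2)"
    using L2_set_le_sum[of UNIV "\<lambda>i. norm (A $ i)"] by (simp add: norm_vec_def[of A] sum_2)
  then show "norm A \<le> 4 * K" using A row[of 1] row[of 2] by simp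
qed

text \<open>Two nonzero vectors span the same line, that is, the same point of the Riemann sphere, exactly
  when this determinant vanishes.\<close>

definition wedge :: "complex^2 \<Rightarrow> complex^2 \<Rightarrow> complex" where
  "wedge v w = v $ 1 * w $ 2 - v $ 2 * w $ 1"

lemma wedge_matrix: "wedge (A *v v) (A *v w) = det A * wedge v w"
  by (simp add: wedge_def matrix_vector_mult_def sum_2 det_2 algebra_simps)

lemma linear_conj: "linear (\<lambda>X :: complex^2^2. A ** X ** B)"
  by (rule linearI)
    (simp_all add: vec_eq_iff forall_2 matrix_matrix_mult_def sum_2 scaleR_add_right
      algebra_simps)

section \<open>Non-elementary discrete groups of matrices\<close>

text \<open>The properties of the preimage in SL(2,C) of a non-elementary Kleinian group on which the
  argument rests; they survive conjugation by any matrix of determinant one. Discreteness appears in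
  the form in which it produces pigeonholes, namely that bounded regions contain finitely many elements.
  The last assumption expresses the infinitude of the orbits on the sphere by lines in \<open>\<complex>\<^sup>2\<close>: no orbit
  is contained in a set of two points.\<close>

locale nonelementary_discrete =
  fixes H :: "(complex^2^2) set"
  assumes det_H: "A \<in> H \<Longrightarrow> det A = 1"
    and one_H: "mat 1 \<in> H"
    and mult_H: "A \<in> H \<Longrightarrow> B \<in> H \<Longrightarrow> A ** B \<in> H"
    and adj2_H: "A \<in> H \<Longrightarrow> adj2 A \<in> H"
    and finite_bounded: "bounded S \<Longrightarrow> finite (H \<inter> S)"
    and infinite_H: "infinite H"
    and orbit_avoids: "v \<noteq> 0 \<Longrightarrow> w \<noteq> 0 \<Longrightarrow> w' \<noteq> 0 \<Longrightarrow>
      \<exists>A\<in>H. wedge (A *v v) w \<noteq> 0 \<and> wedge (A *v v) w' \<noteq> 0"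

context nonelementary_discrete
begin

lemma nonelementary_discrete_conj:
  assumes G: "det G = 1"
  shows "nonelementary_discrete ((\<lambda>A. adj2 G ** A ** G) ` H)"
proof
  note inv = adj2_inverse[OF G]
  define f where "f = (\<lambda>A. adj2 G ** A ** G)"
  define f' where "f' = (\<lambda>A. G ** A ** adj2 G)"
  have cancel: "G ** (adj2 G ** X) = X" "adj2 G ** (G ** X) = X" for X
    by (simp_all add: inv matrix_mul_assoc)
  have f'f: "f' (f X) = X" for X
    by (simp add: f_def f'_def inv cancel matrix_mul_assoc[symmetric])
  have fin: "finite (f ` (H \<inter> f' ` S))" if "bounded S" for S
  proof -
    have "bounded (f' ` S)"
      unfolding f'_def by (intro bounded_linear_image that linear_conv_bounded_linear[THEN iffD1] linear_conj)
    then show ?thesis using finite_bounded by blast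
  qed
  have sub: "f ` H \<inter> S \<subseteq> f ` (H \<inter> f' ` S)" for S
  proof
    fix Y assume "Y \<in> f ` H \<inter> S"
    then obtain X where X: "X \<in> H" "Y = f X" "f X \<in> S" by blast
    then have "X \<in> f' ` S" using f'f[of X] by (metis imageI)
    with X show "Y \<in> f ` (H \<inter> f' ` S)" by blast
  qed
  show "finite ((\<lambda>A. adj2 G ** A ** G) ` H \<inter> S)" if "bounded S" for S
    using finite_subset[OF sub fin[OF that]] by (simp only: f_def)
  have "inj f" using f'f by (metis injI)
  then have "infinite (f ` H)"
    using infinite_H by (simp add: finite_image_iff inj_on_subset[OF _ subset_UNIV])
  then show "infinite ((\<lambda>A. adj2 G ** A ** G) ` H)" unfolding f_def .
  show "mat 1 \<in> (\<lambda>A. adj2 G ** A ** G) ` H"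
    using one_H by (rule rev_image_eqI) (simp add: inv)
  show "A ** B \<in> (\<lambda>A. adj2 G ** A ** G) ` H"
    if AB: "A \<in> (\<lambda>A. adj2 G ** A ** G) ` H" "B \<in> (\<lambda>A. adj2 G ** A ** G) ` H" for A B
  proof -
    obtain X Y where "X \<in> H" "A = adj2 G ** X ** G" "Y \<in> H" "B = adj2 G ** Y ** G"
      using AB by blast
    then show ?thesis
      by (intro rev_image_eqI[OF mult_H[of X Y]]) (simp_all add: cancel flip: matrix_mul_assoc)
  qed
  show "adj2 A \<in> (\<lambda>A. adj2 G ** A ** G) ` H" if "A \<in> (\<lambda>A. adj2 G ** A ** G) ` H" for A
    using that adj2_H by (auto simp: adj2_mult matrix_mul_assoc)
  show "det A = 1" if "A \<in> (\<lambda>A. adj2 G ** A ** G) ` H" for A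
    using that G det_H by (auto simp: det_mul)
  show "\<exists>A\<in>(\<lambda>A. adj2 G ** A ** G) ` H. wedge (A *v v) w \<noteq> 0 \<and> wedge (A *v v) w' \<noteq> 0"
    if ne: "v \<noteq> 0" "w \<noteq> 0" "w' \<noteq> 0" for v w w'
  proof -
    have nz: "G *v x \<noteq> 0" if "x \<noteq> 0" for x
      using that inv(2) by (metis matrix_vector_mul_assoc matrix_vector_mul_lid matrix_vector_mult_0_right)
    obtain A where A: "A \<in> H" "wedge (A *v (G *v v)) (G *v w) \<noteq> 0" "wedge (A *v (G *v v)) (G *v w') \<noteq> 0"
      using orbit_avoids[OF ne[THEN nz]] by blast
    have "wedge ((adj2 G ** A ** G) *v v) x = wedge (A *v (G *v v)) (G *v x)" for x
    proof -
      have "wedge ((adj2 G ** A ** G) *v v) x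
          = wedge (G *v ((adj2 G ** A ** G) *v v)) (G *v x)"
        by (simp add: wedge_matrix G)
      also have "G *v ((adj2 G ** A ** G) *v v) = A *v (G *v v)"
        by (simp add: matrix_vector_mul_assoc cancel flip: matrix_mul_assoc)
      finally show ?thesis .
    qed
    with A show ?thesis by (intro bexI[OF _ imageI[OF A(1)]]) simp
  qed
qed

text \<open>The matrix sends infinity to the point \<open>p / r\<close>, which is neither infinity nor 0.\<close>

lemma moves_infinity: "\<exists>p q r s. mat2 p q r s \<in> H \<and> p \<noteq> 0 \<and> r \<noteq> 0"
proof -
  have ne: "vector [1, 0] \<noteq> (0 :: complex^2)" "vector [0, 1] \<noteq> (0 :: complex^2)"
    by (simp_all add: vec_eq_iff forall_2)
  obtain A where A: "A \<in> H" "wedge (A *v vector [1, 0]) (vector [1, 0]) \<noteq> 0"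
    "wedge (A *v vector [1, 0]) (vector [0, 1]) \<noteq> 0"
    using orbit_avoids[OF ne(1) ne] by blast
  then show ?thesis
    by (cases A rule: mat2_cases) (auto simp: wedge_def matrix_vector_mult_def sum_2)
qed

lemma moves_zero: "\<exists>p q r s. mat2 p q r s \<in> H \<and> q \<noteq> 0"
proof -
  have ne: "vector [0, 1] \<noteq> (0 :: complex^2)"
    by (simp_all add: vec_eq_iff forall_2)
  obtain A where A: "A \<in> H" "wedge (A *v vector [0, 1]) (vector [0, 1]) \<noteq> 0"
    using orbit_avoids[OF ne ne ne] by blast
  then show ?thesis
    by (cases A rule: mat2_cases) (auto simp: wedge_def matrix_vector_mult_def sum_2)
qed

lemma mat2_H_det: "mat2 a b c d \<in> H \<Longrightarrow> a * d - b * c = 1"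
  using det_H by fastforce

end

section \<open>Existence of a loxodromic element\<close>

lemma triangularise:
  assumes "det A = 1"
  shows "\<exists>G x y. det G = 1 \<and> adj2 G ** A ** G = mat2 x y 0 (inverse x) \<and> x \<noteq> 0"
proof -
  define x where "x = (trace A + csqrt ((trace A)\<^sup>2 - 4)) / 2"
  have "(2 * x - trace A)\<^sup>2 = (trace A)\<^sup>2 - 4" by (simp add: x_def add_divide_distrib)
  then have "x\<^sup>2 - trace A * x + 1 = 0" by algebra
  then have root: "x\<^sup>2 - trace A * x + det A = 0" using assms by simp
  have x0: "x \<noteq> 0" using root assms by auto
  obtain v1 v2 where v: "v1 \<noteq> 0 \<or> v2 \<noteq> 0"
    "A $ 1 $ 1 * v1 + A $ 1 $ 2 * v2 = x * v1" "A $ 2 $ 1 * v1 + A $ 2 $ 2 * v2 = x * v2"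
    using eigenvector_exists[OF root] by blast
  \<comment> \<open>complete the eigenvector to a basis of determinant one\<close>
  obtain w1 w2 where w: "v1 * w2 - w1 * v2 = 1"
  proof (cases "v1 = 0")
    case True
    then show ?thesis using that[of 0 "- inverse v2"] that[of "- inverse v2" 0] v(1) by simp
  next
    case False
    then show ?thesis using that[of "inverse v1" 0] by simp
  qed
  define G where "G = mat2 v1 w1 v2 w2"
  have G: "det G = 1" using w by (simp add: G_def)
  obtain a b c d where A: "A = mat2 a b c d" by (rule mat2_cases)
  obtain e f g h where B: "adj2 G ** A ** G = mat2 e f g h" by (rule mat2_cases)
  have eq: "a * v1 + b * v2 = x * v1" "c * v1 + d * v2 = x * v2" using v A by simp_all
  have "e = w2 * (a * v1 + b * v2) - w1 * (c * v1 + d * v2)"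
    using B by (simp add: A G_def algebra_simps)
  also have "\<dots> = x * (v1 * w2 - w1 * v2)" unfolding eq by (simp add: algebra_simps)
  finally have e: "e = x" by (simp add: w)
  have "g = v1 * (c * v1 + d * v2) - v2 * (a * v1 + b * v2)"
    using B by (simp add: A G_def algebra_simps)
  then have g: "g = 0" unfolding eq by (simp add: algebra_simps)
  have "det (adj2 G ** A ** G) = 1" using G assms by (simp add: det_mul)
  then have "x * h = 1" by (simp add: B e g)
  then have "h = inverse x" by (metis inverse_unique)
  with G B e g x0 show ?thesis by blast
qed

lemma diagonalise:
  assumes "det A = 1" "(trace A)\<^sup>2 \<noteq> 4"
  shows "\<exists>G x. det G = 1 \<and> adj2 G ** A ** G = mat2 x 0 0 (inverse x) \<and> x \<noteq> 0 \<and> x \<noteq> inverse x"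
proof -
  obtain G x y where G: "det G = 1" "adj2 G ** A ** G = mat2 x y 0 (inverse x)" "x \<noteq> 0"
    using triangularise[OF assms(1)] by blast
  have "trace A = trace (adj2 G ** (A ** G))"
    using trace_conj_SL2C[OF adj2_inverse(2)[OF G(1)]] by simp
  then have tr: "trace A = x + inverse x" using G(2) by (simp add: matrix_mul_assoc)
  have ne: "x \<noteq> inverse x"
  proof
    assume "x = inverse x"
    then have "x * x = 1" using G(3) by (metis right_inverse)
    moreover have "trace A = x + x" using tr \<open>x = inverse x\<close> by simp
    ultimately show False using assms(2) by (simp add: power2_eq_square)
  qed
  define k where "k = y / (inverse x - x)"
  define K where "K = mat2 1 k 0 1"
  have k: "k * (inverse x - x) = y" using ne by (simp add: k_def)
  have "adj2 (G ** K) ** A ** (G ** K) = adj2 K ** (adj2 G ** A ** G) ** K"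
    by (simp add: adj2_mult matrix_mul_assoc)
  also have "\<dots> = mat2 x 0 0 (inverse x)"
    unfolding G(2) using k by (simp add: K_def algebra_simps)
  finally have "adj2 (G ** K) ** A ** (G ** K) = mat2 x 0 0 (inverse x)" .
  moreover have "det (G ** K) = 1" using G by (simp add: det_mul K_def)
  ultimately show ?thesis using G(3) ne by blast
qed

context nonelementary_discrete
begin

lemma not_bounded_entries:
  assumes "\<And>p q r s. mat2 p q r s \<in> H \<Longrightarrow> cmod p \<le> K \<and> cmod q \<le> K \<and> cmod r \<le> K \<and> cmod s \<le> K"
  shows False
proof -
  have "H \<subseteq> {A :: complex^2^2. cmod (A $ 1 $ 1) \<le> K \<and> cmod (A $ 1 $ 2) \<le> K \<and>
     cmod (A $ 2 $ 1) \<le> K \<and> cmod (A $ 2 $ 2) \<le> K}"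
    using assms by (metis (mono_tags, lifting) mat2_collapse mem_Collect_eq subsetI)
  then show False using finite_bounded[OF bounded_mat2[of K]] infinite_H
    by (simp add: Int_absorb2)
qed

text \<open>If all traces are bounded then so are the diagonal entries \<open>p\<close> and \<open>s\<close> of all elements, because
  \<open>p + s\<close> and \<open>p x + s / x\<close> are two independent linear combinations of them. Multiplying by fixed
  elements that move 0 and infinity mixes the off-diagonal entries into the diagonal, which bounds
  them as well. A bounded discrete group is finite.\<close>

lemma diagonal_imp_unbounded_trace:
  assumes b: "mat2 x 0 0 (inverse x) \<in> H" "x \<noteq> inverse x" "x \<noteq> 0"
  shows "\<exists>A\<in>H. cmod (trace A) > 2"
proof (rule ccontr)
  assume "\<not> ?thesis"
  then have le: "cmod (p + s) \<le> 2" if "mat2 p q r s \<in> H" for p q r s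
    using that by (metis linorder_not_le trace_mat2)
  define K where "K = (2 + 2 * cmod x + 2 / cmod x) / cmod (x - inverse x)"
  have ps: "cmod p \<le> K \<and> cmod s \<le> K" if A: "mat2 p q r s \<in> H" for p q r s
  proof -
    have 1: "cmod (p + s) \<le> 2" using le[OF A] .
    have 2: "cmod (p * x + s * inverse x) \<le> 2"
      using le mult_H[OF A b(1)] by simp
    have "p * (x - inverse x) = (p * x + s * inverse x) - (p + s) * inverse x"
      by (simp add: algebra_simps)
    also have "cmod \<dots> \<le> 2 + 2 / cmod x"
      using norm_triangle_ineq4[of "p * x + s * inverse x" "(p + s) * inverse x"] 2
        divide_right_mono[OF 1, of "cmod x"]
      by (simp add: norm_mult norm_inverse divide_inverse)
    finally have "cmod p * cmod (x - inverse x) \<le> 2 + 2 * cmod x + 2 / cmod x"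
      using norm_ge_zero[of x] unfolding norm_mult by linarith
    moreover have "s * (x - inverse x) = (p + s) * x - (p * x + s * inverse x)"
      by (simp add: algebra_simps)
    then have "cmod (s * (x - inverse x)) \<le> 2 * cmod x + 2"
      using norm_triangle_ineq4[of "(p + s) * x" "p * x + s * inverse x"] 2
        mult_right_mono[OF 1 norm_ge_zero[of x]] by (simp add: norm_mult)
    moreover have "0 \<le> 2 / cmod x" by simp
    ultimately have "cmod s * cmod (x - inverse x) \<le> 2 + 2 * cmod x + 2 / cmod x"
      "cmod p * cmod (x - inverse x) \<le> 2 + 2 * cmod x + 2 / cmod x"
      unfolding norm_mult by linarith+
    then show ?thesis using b(2) by (simp add: K_def pos_le_divide_eq)
  qed
  obtain p0 q0 r0 s0 where 0: "mat2 p0 q0 r0 s0 \<in> H" "q0 \<noteq> 0" using moves_zero by blast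
  obtain p1 q1 r1 s1 where 1: "mat2 p1 q1 r1 s1 \<in> H" "r1 \<noteq> 0" using moves_infinity by blast
  have r: "cmod r \<le> (K + cmod p0 * K) / cmod q0" if A: "mat2 p q r s \<in> H" for p q r s
  proof -
    have "cmod (q0 * r) = cmod ((p0 * p + q0 * r) - p0 * p)" by simp
    also have "\<dots> \<le> cmod (p0 * p + q0 * r) + cmod (p0 * p)" by (rule norm_triangle_ineq4)
    also have "\<dots> \<le> K + cmod p0 * K"
      using ps[OF A] ps mult_H[OF 0(1) A] by (simp add: norm_mult add_mono mult_left_mono)
    finally show ?thesis using 0(2) by (simp add: norm_mult pos_le_divide_eq mult.commute)
  qed
  have q: "cmod q \<le> (K + K * cmod p1) / cmod r1" if A: "mat2 p q r s \<in> H" for p q r s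
  proof -
    have "cmod (q * r1) = cmod ((p * p1 + q * r1) - p * p1)" by simp
    also have "\<dots> \<le> cmod (p * p1 + q * r1) + cmod (p * p1)" by (rule norm_triangle_ineq4)
    also have "\<dots> \<le> K + K * cmod p1"
      using ps[OF A] ps mult_H[OF A 1(1)] by (simp add: norm_mult add_mono mult_right_mono)
    finally show ?thesis using 1(2) by (simp add: norm_mult pos_le_divide_eq mult.commute)
  qed
  define C where "C = max K (max ((K + cmod p0 * K) / cmod q0) ((K + K * cmod p1) / cmod r1))"
  show False
    using not_bounded_entries[of C] ps q r by (metis C_def le_max_iff_disj)
qed

text \<open>Multiplying an element that moves infinity by the powers of a parabolic element fixing infinity
  makes the trace grow linearly.\<close>

lemma parabolic_imp_unbounded_trace:
  assumes b: "mat2 x y 0 x \<in> H" "x * x = 1" "y \<noteq> 0"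
  shows "\<exists>A\<in>H. cmod (trace A) > 2"
proof -
  obtain p q r s where A: "mat2 p q r s \<in> H" "r \<noteq> 0" using moves_infinity by blast
  have pow: "mat2 (x ^ n) (of_nat n * x ^ n * (x * y)) 0 (x ^ n) \<in> H" for n
  proof (induction n)
    case 0
    then show ?case using one_H by (simp add: mat_1_mat2)
  next
    case (Suc n)
    have "mat2 x y 0 x ** mat2 (x ^ n) (of_nat n * x ^ n * (x * y)) 0 (x ^ n)
       = mat2 (x ^ Suc n) (of_nat (Suc n) * x ^ Suc n * (x * y)) 0 (x ^ Suc n)"
      using b(2) by (simp add: algebra_simps)
    then show ?case using mult_H[OF b(1) Suc] by simp
  qed
  have nx: "cmod x = 1"
    using b(2) square_eq_1_iff[of x] by auto
  define t where "t = cmod (r * y)"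
  have t: "t > 0" using A b by (simp add: t_def)
  obtain n where n: "real n * t > 2 + cmod (p + s)"
    using reals_Archimedean3[OF t] by blast
  have "trace (mat2 p q r s ** mat2 (x ^ n) (of_nat n * x ^ n * (x * y)) 0 (x ^ n))
      = x ^ n * ((p + s) + of_nat n * x * (r * y))"
    by (simp add: algebra_simps)
  moreover have "cmod (x ^ n * ((p + s) + of_nat n * x * (r * y))) \<ge> real n * t - cmod (p + s)"
    (is "_ \<le> cmod ?tr")
    using norm_diff_ineq[of "of_nat n * x * (r * y)" "p + s"]
    by (simp add: norm_mult norm_power nx t_def add.commute)
  ultimately have "trace (mat2 p q r s ** mat2 (x ^ n) (of_nat n * x ^ n * (x * y)) 0 (x ^ n)) = ?tr" "2 < cmod ?tr"
    using n by linarith+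
  then have "2 < cmod (trace (mat2 p q r s ** mat2 (x ^ n) (of_nat n * x ^ n * (x * y)) 0 (x ^ n)))"
    by simp
  then show ?thesis using mult_H[OF A(1) pow[of n]] by blast
qed

lemma exists_trace_gt_2: "\<exists>A\<in>H. cmod (trace A) > 2"
proof -
  have "\<not> H \<subseteq> {mat 1, - mat 1}" using infinite_H finite_subset by blast
  then obtain A where A: "A \<in> H" "A \<noteq> mat 1" "A \<noteq> - mat 1" by blast
  have conj: "trace (adj2 G ** B ** G) = trace B" if "det G = 1" for G B
    using trace_conj_SL2C[OF adj2_inverse(2)[OF that]] by (simp add: matrix_mul_assoc)
  obtain G x y where G: "det G = 1" "adj2 G ** A ** G = mat2 x y 0 (inverse x)" "x \<noteq> 0"
    using triangularise[OF det_H[OF A(1)]] by blast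
  show ?thesis
  proof (cases "(trace A)\<^sup>2 = 4")
    case False
    obtain G x where G: "det G = 1" "adj2 G ** A ** G = mat2 x 0 0 (inverse x)" "x \<noteq> 0" "x \<noteq> inverse x"
      using diagonalise[OF det_H[OF A(1)] False] by blast
    interpret C: nonelementary_discrete "(\<lambda>A. adj2 G ** A ** G) ` H"
      by (rule nonelementary_discrete_conj[OF G(1)])
    have "mat2 x 0 0 (inverse x) \<in> (\<lambda>A. adj2 G ** A ** G) ` H" using A(1) G(2)[symmetric] by simp
    from C.diagonal_imp_unbounded_trace[OF this G(4,3)] show ?thesis by (auto simp: conj[OF G(1)])
  next
    case True
    have "trace A = x + inverse x" using conj[OF G(1), of A] G(2) by simp
    with True have "(x - inverse x)\<^sup>2 = 0" using G(3)
      by (simp add: power2_eq_square algebra_simps)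
    then have xx: "inverse x = x" by simp
    have x1: "x * x = 1" using xx G(3) by (metis right_inverse)
    have "y \<noteq> 0"
    proof
      assume "y = 0"
      have "A = G ** (adj2 G ** A ** G) ** adj2 G"
        by (simp add: adj2_inverse[OF G(1)] matrix_mul_assoc)
          (simp add: adj2_inverse[OF G(1)] flip: matrix_mul_assoc)
      also have "adj2 G ** A ** G = (if x = 1 then mat 1 else - mat 1)"
        using x1 \<open>y = 0\<close> unfolding G(2) xx by (auto simp: mat_1_mat2 square_eq_1_iff)
      finally show False using A
        by (auto simp: adj2_inverse[OF G(1)] matrix_mul_uminus_left matrix_mul_uminus_right split: if_splits)
    qed
    interpret C: nonelementary_discrete "(\<lambda>A. adj2 G ** A ** G) ` H"
      by (rule nonelementary_discrete_conj[OF G(1)])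
    have "mat2 x y 0 x \<in> (\<lambda>A. adj2 G ** A ** G) ` H" using A(1) G(2)[symmetric] xx by simp
    from C.parabolic_imp_unbounded_trace[OF this x1 \<open>y \<noteq> 0\<close>] show ?thesis
      by (auto simp: conj[OF G(1)])
  qed
qed

end

section \<open>Conjugators between long translates\<close>

lemma ex_power_interval:
  fixes a x :: real
  assumes "a > 1" "x \<ge> 1"
  shows "\<exists>m. a ^ m \<le> x \<and> x < a ^ Suc m"
proof -
  define n where "n = (LEAST n. x < a ^ n)"
  have ex: "\<exists>n. x < a ^ n" using assms(1) by (rule real_arch_pow)
  have n: "x < a ^ n" unfolding n_def using ex by (rule LeastI_ex)
  obtain m where m: "n = Suc m" using n assms(2) by (cases n) auto
  have "\<not> x < a ^ m" using not_less_Least[of m "\<lambda>n. x < a ^ n"] m unfolding n_def by simp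
  with n m show ?thesis by (intro exI[of _ m]) simp
qed

text \<open>The matrices \<open>u\<close> and \<open>v\<close> with rows \<open>(p, q), (r, s)\<close> and \<open>(p, q'), (r', s)\<close> share their diagonal.
  Let \<open>U = u diag(l, 1/l)\<close> and \<open>V = v diag(l, 1/l)\<close>, and let \<open>h U = V h\<close>. Comparing entries, \<open>\<gamma>\<close>
  is a linear combination of \<open>\<alpha>\<close> and \<open>\<delta>\<close>, and \<open>\<beta>\<close> is \<open>\<gamma>\<close> divided by \<open>l\<^sup>2\<close> up to a factor, so that \<open>h\<close>
  is almost lower triangular. The conjugators of \<open>U\<close> to \<open>V\<close> include \<open>h U\<^sup>k\<close> for all \<open>k\<close>;
  as \<open>U\<close> has an eigenvalue of size about \<open>p l\<close>, passing to \<open>h U\<close> multiplies \<open>\<alpha>\<close> by that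
  factor and divides \<open>\<delta>\<close> by it. If neither \<open>h U\<close> nor \<open>h U\<inverse>\<close> is smaller than \<open>h\<close>, the sizes of \<open>\<alpha>\<close> and
  \<open>\<delta>\<close> therefore differ at most by a factor of order \<open>l\<close>; since their product is close to 1, both are at most of
  order \<open>\<surd>l\<close>. The two hypotheses on \<open>\<mu>\<close> in the statement are this minimality.\<close>

lemma conjugator_bounds:
  fixes p q r s q' r' :: complex
  assumes p: "p \<noteq> 0" and r: "r \<noteq> 0"
  shows "\<exists>C N. C > 0 \<and> N > 0 \<and> (\<forall>l \<alpha> \<beta> \<gamma> \<delta> \<mu>. cmod l \<ge> N \<longrightarrow>
     \<alpha> * \<delta> - \<beta> * \<gamma> = 1 \<longrightarrow>
     \<mu> = max (cmod \<alpha>) (cmod \<delta>) \<longrightarrow>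
     mat2 \<alpha> \<beta> \<gamma> \<delta> ** mat2 (p * l) (q / l) (r * l) (s / l)
       = mat2 (p * l) (q' / l) (r' * l) (s / l) ** mat2 \<alpha> \<beta> \<gamma> \<delta> \<longrightarrow>
     cmod \<gamma> \<le> C * \<mu> \<and> cmod \<beta> \<le> C * cmod \<gamma> / (cmod l)\<^sup>2 \<and>
     (\<mu> \<le> max (cmod (\<alpha> * (s / l) - \<beta> * (r * l))) (cmod (\<delta> * (p * l) - \<gamma> * (q / l))) \<longrightarrow>
      \<mu> \<le> max (cmod (\<alpha> * (p * l) + \<beta> * (r * l))) (cmod (\<gamma> * (q / l) + \<delta> * (s / l))) \<longrightarrow>
      cmod (\<alpha> * \<delta> - 1) \<le> 1 / 2 \<and> \<mu>\<^sup>2 \<le> C * cmod l))"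
proof -
  define P where "P = cmod p"
  have P: "P > 0" using p by (simp add: P_def)
  define c1 where "c1 = 2 * (cmod r' + cmod r) / P"
  define c2 where "c2 = cmod q' / cmod r"
  define c3 where "c3 = cmod s + (cmod q' + cmod q) * c1"
  have c: "c1 > 0" "c2 \<ge> 0" "c3 \<ge> 0" using P r by (simp_all add: c1_def c2_def c3_def add_nonneg_pos)
  define C where "C = max (4 * P) (max c1 c2)"
  define N where "N = 1 + 2 * cmod s / P + 2 * c3 + 8 * P * c2 * c1\<^sup>2"
  have C: "C > 0" "4 * P \<le> C" "c1 \<le> C" "c2 \<le> C" using P by (auto simp: C_def less_max_iff_disj)
  have "0 \<le> 2 * cmod s / P" "0 \<le> 8 * P * c2 * c1\<^sup>2" using P c by simp_all
  then have N: "N \<ge> 1" "2 * cmod s / P < N" "2 * c3 < N" "8 * P * c2 * c1\<^sup>2 < N"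
    using c unfolding N_def by linarith+
  show ?thesis
  proof (rule exI[of _ C], rule exI[of _ N], intro conjI allI impI)
    show "C > 0" "N > 0" using C N by simp_all
    fix l \<alpha> \<beta> \<gamma> \<delta> :: complex and \<mu> :: real
    assume l: "cmod l \<ge> N" and det: "\<alpha> * \<delta> - \<beta> * \<gamma> = 1" and \<mu>: "\<mu> = max (cmod \<alpha>) (cmod \<delta>)"
      and eq: "mat2 \<alpha> \<beta> \<gamma> \<delta> ** mat2 (p * l) (q / l) (r * l) (s / l)
       = mat2 (p * l) (q' / l) (r' * l) (s / l) ** mat2 \<alpha> \<beta> \<gamma> \<delta>"
    define L where "L = cmod l"
    have L: "L \<ge> 1" "L \<ge> N" using l N by (simp_all add: L_def)
    have l0: "l \<noteq> 0" using L(1) by (auto simp: L_def)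
    \<comment> \<open>the upper left entry determines \<open>\<beta>\<close>, the lower left one determines \<open>\<gamma>\<close>\<close>
    have "\<alpha> * (p * l) + \<beta> * (r * l) = p * l * \<alpha> + q' / l * \<gamma>" using eq by simp
    then have e1: "\<beta> * (r * l) = q' * \<gamma> / l" by simp
    then have e1': "\<beta> = q' * \<gamma> / (r * l\<^sup>2)" using l0 r by (simp add: field_simps power2_eq_square)
    have "\<gamma> * (p * l) + \<delta> * (r * l) = r' * l * \<alpha> + s / l * \<gamma>" using eq by simp
    then have e3: "\<gamma> * (p - s / l\<^sup>2) = r' * \<alpha> - r * \<delta>"
      using l0 by (simp add: field_simps power2_eq_square)
    have \<mu>le: "cmod \<alpha> \<le> \<mu>" "cmod \<delta> \<le> \<mu>" by (simp_all add: \<mu>)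
    have "L \<le> L\<^sup>2" using L(1) by (simp add: power2_eq_square)
    have "cmod (s / l\<^sup>2) \<le> P / 2"
    proof -
      have "2 * cmod s < N * P" using N(2) P by (simp add: pos_divide_less_eq)
      also have "N * P \<le> L\<^sup>2 * P" using L(2) \<open>L \<le> L\<^sup>2\<close> P by (intro mult_right_mono) auto
      finally have "2 * cmod s / L\<^sup>2 \<le> P" using L(1) by (simp add: pos_divide_le_eq mult.commute)
      then show ?thesis by (simp add: norm_divide norm_power L_def mult.commute)
    qed
    then have "cmod (p - s / l\<^sup>2) \<ge> P / 2"
      using norm_triangle_ineq2[of p "s / l\<^sup>2"] by (simp add: P_def)
    then have "cmod \<gamma> * (P / 2) \<le> cmod (\<gamma> * (p - s / l\<^sup>2))"
      unfolding norm_mult by (intro mult_left_mono) auto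
    also have "\<dots> \<le> cmod r' * cmod \<alpha> + cmod r * cmod \<delta>"
      unfolding e3 using norm_triangle_ineq4[of "r' * \<alpha>" "r * \<delta>"] by (simp add: norm_mult)
    also have "\<dots> \<le> (cmod r' + cmod r) * \<mu>"
      using \<mu>le by (simp add: distrib_right add_mono mult_left_mono)
    finally have g: "cmod \<gamma> \<le> c1 * \<mu>" using P by (simp add: c1_def field_simps)
    have \<mu>0: "\<mu> \<ge> 0" using \<mu>le(1) norm_ge_zero[of \<alpha>] by linarith
    show "cmod \<gamma> \<le> C * \<mu>"
      using g mult_right_mono[OF C(3) \<mu>0] by linarith
    have b: "cmod \<beta> = c2 * cmod \<gamma> / L\<^sup>2"
      unfolding e1' by (simp add: norm_divide norm_mult norm_power c2_def L_def)
    show "cmod \<beta> \<le> C * cmod \<gamma> / (cmod l)\<^sup>2"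
      unfolding b L_def[symmetric] using C(4) by (intro divide_right_mono mult_right_mono) auto
    assume m1: "\<mu> \<le> max (cmod (\<alpha> * (s / l) - \<beta> * (r * l))) (cmod (\<delta> * (p * l) - \<gamma> * (q / l)))"
      and m2: "\<mu> \<le> max (cmod (\<alpha> * (p * l) + \<beta> * (r * l))) (cmod (\<gamma> * (q / l) + \<delta> * (s / l)))"
    have \<mu>pos: "\<mu> > 0"
    proof (rule ccontr)
      assume "\<not> \<mu> > 0"
      then have "\<mu> = 0" using \<mu>0 by simp
      then have "\<alpha> = 0" "\<delta> = 0" "\<gamma> = 0" using \<mu>le g by auto
      with det show False by simp
    qed
    have qg: "cmod (q * \<gamma> / l) \<le> cmod q * c1 * \<mu> / L" "cmod (q' * \<gamma> / l) \<le> cmod q' * c1 * \<mu> / L"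
      using g L(1) by (simp_all add: norm_mult norm_divide L_def divide_right_mono mult_left_mono mult.assoc)
    have sd: "cmod (\<alpha> * s / l) \<le> cmod s * \<mu> / L" "cmod (\<delta> * s / l) \<le> cmod s * \<mu> / L"
      using \<mu>le L(1)
      by (simp_all add: norm_mult norm_divide L_def divide_right_mono mult_right_mono mult.commute[of "cmod s"])
    have c3L: "c3 * \<mu> / L < \<mu> / 2"
    proof -
      have "2 * c3 < L" using N L by linarith
      then have "2 * c3 * \<mu> < L * \<mu>" using \<mu>pos by (rule mult_strict_right_mono)
      then show ?thesis using L(1) by (simp add: field_simps)
    qed
    have c3s: "c3 * \<mu> / L = cmod s * \<mu> / L + cmod q' * c1 * \<mu> / L + cmod q * c1 * \<mu> / L"
      by (simp add: c3_def field_simps add_divide_distrib)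
    have nn: "0 \<le> cmod s * \<mu> / L" "0 \<le> cmod q' * c1 * \<mu> / L" "0 \<le> cmod q * c1 * \<mu> / L"
      using \<mu>0 L(1) c by simp_all
    \<comment> \<open>the upper left entry of \<open>h U\<inverse>\<close> is too small to reach \<open>\<mu>\<close>, so the lower
      right entry must be at least \<open>\<mu>\<close>\<close>
    have "cmod (\<alpha> * (s / l) - \<beta> * (r * l)) < \<mu>"
      using norm_triangle_ineq4[of "\<alpha> * s / l" "q' * \<gamma> / l"] sd(1) qg(2) c3L c3s nn \<mu>pos
      unfolding e1 times_divide_eq_right by linarith
    then have "\<mu> \<le> cmod (\<delta> * (p * l) - \<gamma> * (q / l))" using m1 by simp
    also have "\<dots> \<le> cmod (\<delta> * (p * l)) + cmod (q * \<gamma> / l)"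
      using norm_triangle_ineq4[of "\<delta> * (p * l)" "\<gamma> * (q / l)"] by (simp add: mult.commute)
    finally have "\<mu> / 2 \<le> cmod (\<delta> * (p * l))" using qg(1) c3L c3s nn by linarith
    then have d: "\<mu> / (2 * P * L) \<le> cmod \<delta>"
      using P L(1) by (simp add: norm_mult P_def[symmetric] L_def[symmetric] field_simps)
    \<comment> \<open>symmetrically for \<open>h U\<close>\<close>
    have "cmod (\<gamma> * (q / l) + \<delta> * (s / l)) < \<mu>"
      using norm_triangle_ineq[of "q * \<gamma> / l" "\<delta> * s / l"] sd(2) qg(1) c3L c3s nn \<mu>pos
      unfolding times_divide_eq_right mult.commute[of \<gamma> q] by linarith
    then have "\<mu> \<le> cmod (\<alpha> * (p * l) + \<beta> * (r * l))" using m2 by simp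
    also have "\<dots> \<le> cmod (\<alpha> * (p * l)) + cmod (q' * \<gamma> / l)"
      unfolding e1 by (rule norm_triangle_ineq)
    finally have "\<mu> / 2 \<le> cmod (\<alpha> * (p * l))" using qg(2) c3L c3s nn by linarith
    then have a: "\<mu> / (2 * P * L) \<le> cmod \<alpha>"
      using P L(1) by (simp add: norm_mult P_def[symmetric] L_def[symmetric] field_simps)
    have ad: "\<mu> * (\<mu> / (2 * P * L)) \<le> cmod (\<alpha> * \<delta>)"
    proof (cases "cmod \<alpha> \<le> cmod \<delta>")
      case True
      then have "\<mu> = cmod \<delta>" by (simp add: \<mu>)
      then show ?thesis using mult_right_mono[OF a, of "cmod \<delta>"] by (simp add: norm_mult mult.commute)
    next
      case False
      then have "\<mu> = cmod \<alpha>" by (simp add: \<mu>)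
      then show ?thesis using mult_left_mono[OF d, of "cmod \<alpha>"] by (simp add: norm_mult)
    qed
    have bg: "cmod (\<beta> * \<gamma>) \<le> c2 * c1\<^sup>2 * \<mu>\<^sup>2 / L\<^sup>2"
    proof -
      have "cmod (\<beta> * \<gamma>) = c2 * (cmod \<gamma>)\<^sup>2 / L\<^sup>2"
        unfolding norm_mult b by (simp add: power2_eq_square)
      also have "\<dots> \<le> c2 * (c1 * \<mu>)\<^sup>2 / L\<^sup>2"
        using g c(2) by (intro divide_right_mono mult_left_mono power_mono) auto
      finally show ?thesis by (simp add: power_mult_distrib)
    qed
    have cL: "8 * P * c2 * c1\<^sup>2 \<le> L" using N L by linarith
    have bg2: "c2 * c1\<^sup>2 * \<mu>\<^sup>2 / L\<^sup>2 \<le> \<mu>\<^sup>2 / (8 * P * L)"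
    proof -
      have "8 * P * c2 * c1\<^sup>2 * \<mu>\<^sup>2 \<le> L * \<mu>\<^sup>2" using cL by (rule mult_right_mono) simp
      then show ?thesis using L(1) P by (simp add: field_simps power2_eq_square)
    qed
    have ad1: "\<alpha> * \<delta> = 1 + \<beta> * \<gamma>" using det by (simp add: algebra_simps)
    have "cmod (\<alpha> * \<delta>) \<le> 1 + cmod (\<beta> * \<gamma>)"
      unfolding ad1 using norm_triangle_ineq[of 1 "\<beta> * \<gamma>"] by simp
    then have "\<mu>\<^sup>2 / (2 * P * L) \<le> 1 + \<mu>\<^sup>2 / (8 * P * L)"
      using ad bg bg2 by (simp add: power2_eq_square)
    then have "\<mu>\<^sup>2 * 3 / (8 * P * L) \<le> 1"
      using P L(1) by (simp add: field_simps)
    then have mu: "\<mu>\<^sup>2 * 3 \<le> 8 * P * L" using P L(1) by (simp add: pos_divide_le_eq)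
    then have mu4: "\<mu>\<^sup>2 \<le> 4 * P * L" using P L(1) mult_pos_pos[of P L] by linarith
    then show "\<mu>\<^sup>2 \<le> C * cmod l"
      using mult_right_mono[OF C(2), of L] L(1) by (simp add: L_def)
    have "\<mu>\<^sup>2 / (8 * P * L) \<le> 1 / 2"
      using mu4 P L(1) by (simp add: pos_divide_le_eq mult_ac)
    then show "cmod (\<alpha> * \<delta> - 1) \<le> 1 / 2"
      using order_trans[OF order_trans[OF bg bg2]] by (simp only: ad1 add_diff_cancel_left')
  qed
qed

context nonelementary_discrete
begin

lemma pigeonhole_H:
  assumes I: "infinite (I :: nat set)"
    and H: "\<And>i. i \<in> I \<Longrightarrow> mat2 (a i) (b i) (c i) (d i) \<in> H"
    and K: "\<And>i. i \<in> I \<Longrightarrow> cmod (a i) \<le> K \<and> cmod (b i) \<le> K \<and> cmod (c i) \<le> K \<and> cmod (d i) \<le> K"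
  shows "\<exists>A\<in>H. infinite {i\<in>I. mat2 (a i) (b i) (c i) (d i) = A}"
proof -
  define f where "f = (\<lambda>i. mat2 (a i) (b i) (c i) (d i))"
  have "f ` I \<subseteq> H \<inter> {A :: complex^2^2. cmod (A $ 1 $ 1) \<le> K \<and> cmod (A $ 1 $ 2) \<le> K \<and>
     cmod (A $ 2 $ 1) \<le> K \<and> cmod (A $ 2 $ 2) \<le> K}"
    using H K by (auto simp: f_def)
  then have "finite (f ` I)" using finite_bounded[OF bounded_mat2] finite_subset by blast
  from pigeonhole_infinite[OF I this] obtain j where "j \<in> I" "infinite {i \<in> I. f i = f j}" by blast
  then show ?thesis using H[of j] unfolding f_def by blast
qed

end

locale diagonal_loxodromic = nonelementary_discrete +
  fixes x :: complex
  assumes norm_x: "cmod x > 1"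
    and diag_x: "mat2 x 0 0 (inverse x) \<in> H"
begin

lemma x0: "x \<noteq> 0" using norm_x by auto

lemma diag_power: "mat2 (x ^ n) 0 0 (inverse (x ^ n)) \<in> H"
proof (induction n)
  case 0
  then show ?case using one_H by (simp add: mat_1_mat2)
next
  case (Suc n)
  then show ?case using mult_H[OF diag_x Suc] by (simp add: mult.commute)
qed

lemma diag_power_inv: "mat2 (inverse (x ^ n)) 0 0 (x ^ n) \<in> H"
  using adj2_H[OF diag_power[of n]] by simp

text \<open>A lower triangular element fixes 0, a fixed point of the loxodromic element \<open>diag(x, 1/x)\<close>. In a discrete
  group it then fixes the other fixed point, infinity, too: otherwise its conjugates by the powers of
  \<open>diag(x, 1/x)\<close> would be infinitely many elements converging to a diagonal matrix.\<close>

lemma lower_triangular_is_diagonal: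
  assumes A: "mat2 a 0 c d \<in> H"
  shows "c = 0"
proof (rule ccontr)
  assume c: "c \<noteq> 0"
  define f where "f k = c * inverse (x ^ k) * inverse (x ^ k)" for k
  have f: "mat2 a 0 (f k) d \<in> H" for k
    using mult_H[OF mult_H[OF diag_power[of k] A] diag_power_inv[of k]] x0
    by (simp add: f_def mult_ac)
  have fk: "cmod (f k) = cmod c / (cmod x ^ k)\<^sup>2" for k
    by (simp add: f_def norm_mult norm_inverse norm_power divide_inverse power2_eq_square)
  have "1 \<le> cmod x ^ k" for k using norm_x by simp
  then have "cmod (f k) \<le> cmod c" for k
    unfolding fk by (simp add: divide_le_eq mult_le_cancel_left1 power2_eq_square) (smt (verit) mult_le_cancel_left1 norm_ge_zero)
  then obtain A where A: "infinite {i\<in>UNIV. mat2 a 0 (f i) d = A}"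
    using pigeonhole_H[of UNIV "\<lambda>_. a" "\<lambda>_. 0" f "\<lambda>_. d" "max (cmod a) (max (cmod c) (cmod d))"] f
    by (auto simp: le_max_iff_disj)
  have "inj f"
  proof (rule injI)
    fix k m assume "f k = f m"
    then have "cmod (f k) = cmod (f m)" by simp
    then have "(cmod x ^ k)\<^sup>2 = (cmod x ^ m)\<^sup>2"
      unfolding fk using c x0 by (simp add: field_simps)
    then have "cmod x ^ (k * 2) = cmod x ^ (m * 2)" by (simp add: power_mult)
    then show "k = m" using norm_x by simp
  qed
  then have "finite (f -` {A $ 2 $ 1})" by (simp add: finite_vimageI)
  moreover have "{i\<in>UNIV. mat2 a 0 (f i) d = A} \<subseteq> f -` {A $ 2 $ 1}" by auto
  ultimately show False using A finite_subset by blast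
qed

lemma ex_power_gt: "\<exists>n. \<forall>M\<ge>n. K < cmod x ^ M"
proof -
  obtain n where n: "K < cmod x ^ n" using real_arch_pow[OF norm_x] by blast
  have "K < cmod x ^ M" if "M \<ge> n" for M
    using n power_increasing[OF that, of "cmod x"] norm_x by linarith
  then show ?thesis by blast
qed

text \<open>The matrix \<open>h\<^sub>M\<close> with rows \<open>(\<alpha>, \<beta>), (\<gamma>, \<delta>)\<close> stretches by a factor of about \<open>\<bar>\<alpha>\<bar>\<^sup>2\<close> along the axis of
  \<open>diag(x, 1/x)\<close>. Undoing this stretch by the power \<open>diag(x, 1/x)\<^sup>-\<^sup>m\<close> with \<open>\<bar>x\<bar>\<^sup>m\<close> comparable to \<open>\<bar>\<alpha>\<bar>\<close> gives elements of the
  group whose entries are bounded, so one and the same element \<open>A\<close> arises for infinitely many \<open>M\<close>. The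
  bound on \<open>\<alpha>\<close> ensures that the upper right entries tend to 0; hence \<open>A\<close> is lower triangular, and
  therefore diagonal.\<close>

lemma conjugator_diagonal:
  fixes I :: "nat set"
  assumes I: "infinite I" and C: "C > 0"
    and H: "\<And>M. M \<in> I \<Longrightarrow> mat2 (\<alpha> M) (\<beta> M) (\<gamma> M) (\<delta> M) \<in> H"
    and \<delta>\<alpha>: "\<And>M. M \<in> I \<Longrightarrow> cmod (\<delta> M) \<le> cmod (\<alpha> M)"
    and \<alpha>\<delta>: "\<And>M. M \<in> I \<Longrightarrow> cmod (\<alpha> M * \<delta> M - 1) \<le> 1 / 2"
    and \<alpha>: "\<And>M. M \<in> I \<Longrightarrow> (cmod (\<alpha> M))\<^sup>2 \<le> C * cmod x ^ M"
    and \<gamma>: "\<And>M. M \<in> I \<Longrightarrow> cmod (\<gamma> M) \<le> C * cmod (\<alpha> M)"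
    and \<beta>: "\<And>M. M \<in> I \<Longrightarrow> cmod (\<beta> M) \<le> C * cmod (\<gamma> M) / (cmod x ^ M)\<^sup>2"
  shows "\<exists>M\<in>I. \<beta> M = 0 \<and> \<gamma> M = 0"
proof -
  define X where "X = cmod x"
  have X: "X > 1" using norm_x by (simp add: X_def)
  have \<alpha>\<delta>_bounds: "1 / 2 \<le> cmod (\<alpha> M) * cmod (\<delta> M) \<and> cmod (\<alpha> M) * cmod (\<delta> M) \<le> 3 / 2"
    if "M \<in> I" for M
    using \<alpha>\<delta>[OF that] norm_triangle_ineq2[of 1 "1 - \<alpha> M * \<delta> M"]
      norm_triangle_ineq2[of "\<alpha> M * \<delta> M" 1]
    by (simp add: norm_mult norm_minus_commute)
  have "\<exists>m. X ^ m \<le> 2 * cmod (\<alpha> M) \<and> 2 * cmod (\<alpha> M) < X ^ Suc m" if M: "M \<in> I" for M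
  proof (rule ex_power_interval[OF X])
    have "1 / 2 \<le> (cmod (\<alpha> M))\<^sup>2"
      using \<alpha>\<delta>_bounds[OF M] mult_left_mono[OF \<delta>\<alpha>[OF M], of "cmod (\<alpha> M)"]
      by (simp add: power2_eq_square)
    then have "1\<^sup>2 \<le> (2 * cmod (\<alpha> M))\<^sup>2" by (simp add: power_mult_distrib)
    then show "1 \<le> 2 * cmod (\<alpha> M)" by (rule power2_le_imp_le) simp
  qed
  then obtain m where m: "\<And>M. M \<in> I \<Longrightarrow> X ^ m M \<le> 2 * cmod (\<alpha> M)"
    "\<And>M. M \<in> I \<Longrightarrow> 2 * cmod (\<alpha> M) < X ^ Suc (m M)"
    by metis
  define a b c d where "a M = \<alpha> M * inverse (x ^ m M)" and "b M = \<beta> M * x ^ m M"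
    and "c M = \<gamma> M * inverse (x ^ m M)" and "d M = \<delta> M * x ^ m M" for M
  have abcd: "mat2 (a M) (b M) (c M) (d M) \<in> H" if "M \<in> I" for M
    using mult_H[OF H[OF that] diag_power_inv[of "m M"]]
    by (simp add: a_def b_def c_def d_def)
  have Xm: "X ^ k \<ge> 1" "X ^ k > 0" for k using X by simp_all
  have a: "cmod (a M) \<le> X" if M: "M \<in> I" for M
  proof -
    have "cmod (\<alpha> M) \<le> X * X ^ m M" using m(2)[OF M] norm_ge_zero[of "\<alpha> M"]
      unfolding power_Suc by linarith
    then have "cmod (\<alpha> M) / X ^ m M \<le> X" using Xm(2)[of "m M"] by (simp add: pos_divide_le_eq)
    then show ?thesis by (simp add: a_def norm_mult norm_inverse norm_power X_def divide_inverse)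
  qed
  have c: "cmod (c M) \<le> C * X" if M: "M \<in> I" for M
  proof -
    have "cmod (c M) = cmod (\<gamma> M) / X ^ m M"
      by (simp add: c_def norm_mult norm_inverse norm_power X_def divide_inverse)
    also have "\<dots> \<le> C * cmod (\<alpha> M) / X ^ m M"
      using \<gamma>[OF M] Xm(2)[of "m M"] by (intro divide_right_mono) auto
    also have "\<dots> = C * cmod (a M)"
      by (simp add: a_def norm_mult norm_inverse norm_power X_def divide_inverse)
    also have "\<dots> \<le> C * X" using a[OF M] C by simp
    finally show ?thesis .
  qed
  have d: "cmod (d M) \<le> 3" if M: "M \<in> I" for M
  proof -
    have "cmod (d M) \<le> cmod (\<delta> M) * (2 * cmod (\<alpha> M))"
      using m(1)[OF M] by (simp add: d_def norm_mult norm_power X_def mult_left_mono)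
    also have "\<dots> = 2 * (cmod (\<alpha> M) * cmod (\<delta> M))" by simp
    finally show ?thesis using \<alpha>\<delta>_bounds[OF M] by linarith
  qed
  have b: "cmod (b M) \<le> 2 * C ^ 3 / X ^ M" if M: "M \<in> I" for M
  proof -
    have "cmod (b M) \<le> (C * cmod (\<gamma> M) / (X ^ M)\<^sup>2) * (2 * cmod (\<alpha> M))"
      unfolding b_def norm_mult norm_power X_def[symmetric]
      using \<beta>[OF M] m(1)[OF M] Xm(2)[of "m M"] C unfolding X_def[symmetric] by (intro mult_mono) auto
    also have "\<dots> \<le> (C * (C * cmod (\<alpha> M)) / (X ^ M)\<^sup>2) * (2 * cmod (\<alpha> M))"
      using \<gamma>[OF M] C by (intro mult_right_mono divide_right_mono mult_left_mono) auto
    also have "\<dots> = 2 * C\<^sup>2 * (cmod (\<alpha> M))\<^sup>2 / (X ^ M)\<^sup>2" by (simp add: power2_eq_square)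
    also have "\<dots> \<le> 2 * C\<^sup>2 * (C * X ^ M) / (X ^ M)\<^sup>2"
      using \<alpha>[OF M] C unfolding X_def by (intro divide_right_mono mult_left_mono) auto
    also have "\<dots> = 2 * C ^ 3 / X ^ M"
      using Xm(2)[of M] by (simp add: power2_eq_square power3_eq_cube)
    finally show ?thesis .
  qed
  have b': "cmod (b M) \<le> 2 * C ^ 3" if M: "M \<in> I" for M
    using b[OF M] Xm(1)[of M] C divide_left_mono[of 1 "X ^ M" "2 * C ^ 3"] by simp
  define K where "K = X + C * X + 3 + 2 * C ^ 3"
  have "cmod (a M) \<le> K \<and> cmod (b M) \<le> K \<and> cmod (c M) \<le> K \<and> cmod (d M) \<le> K" if M: "M \<in> I" for M
  proof -
    have "C * X > 0" "C ^ 3 > 0" "X > 0" using C X by simp_all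
    then show ?thesis using a[OF M] b'[OF M] c[OF M] d[OF M] unfolding K_def by linarith
  qed
  then obtain A where
    A: "A \<in> H" "infinite {M\<in>I. mat2 (a M) (b M) (c M) (d M) = A}"
    using pigeonhole_H[OF I, of a b c d K] abcd by blast
  obtain a0 b0 c0 d0 where A_eq: "A = mat2 a0 b0 c0 d0" by (rule mat2_cases)
  define J where "J = {M\<in>I. mat2 (a M) (b M) (c M) (d M) = A}"
  have J: "M \<in> I" "b M = b0" "c M = c0" if "M \<in> J" for M
    using that by (auto simp: J_def A_eq)
  have b0: "b0 = 0"
  proof (rule ccontr)
    assume ne: "b0 \<noteq> 0"
    obtain n where n: "\<And>M. M \<ge> n \<Longrightarrow> 2 * C ^ 3 / cmod b0 < X ^ M"
      using ex_power_gt unfolding X_def by meson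
    obtain M where M: "M \<in> J" "M \<ge> n"
      using A(2) unfolding J_def[symmetric] by (meson infinite_nat_iff_unbounded_le)
    have "cmod b0 * X ^ M \<le> 2 * C ^ 3"
      using b[OF J(1)[OF M(1)]] J(2)[OF M(1)] Xm(2)[of M] by (simp add: pos_le_divide_eq)
    then show False using n[OF M(2)] ne by (simp add: pos_divide_less_eq mult.commute)
  qed
  have c0: "c0 = 0" using A(1) lower_triangular_is_diagonal unfolding A_eq b0 by blast
  obtain M where M: "M \<in> J" using infinite_imp_nonempty[OF A(2)] unfolding J_def[symmetric] by blast
  have "\<beta> M = 0" "\<gamma> M = 0"
    using J(2,3)[OF M] b0 c0 x0 by (simp_all add: b_def c_def)
  then show ?thesis using J(1)[OF M] by blast
qed

text \<open>Among the conjugators in the group there is one of least size, by discreteness, and to this one the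
  estimates of \<open>conjugator_bounds\<close> apply.\<close>

lemma ex_minimal_conjugator:
  assumes p: "p \<noteq> 0" and r: "r \<noteq> 0"
    and u: "mat2 p q r s \<in> H"
  shows "\<exists>C n. C > 0 \<and> (\<forall>M\<ge>n.
     (\<exists>h\<in>H. h ** (mat2 p q r s ** mat2 (x ^ M) 0 0 (inverse (x ^ M)))
        = mat2 p q' r' s ** mat2 (x ^ M) 0 0 (inverse (x ^ M)) ** h) \<longrightarrow>
     (\<exists>\<alpha> \<beta> \<gamma> \<delta>. mat2 \<alpha> \<beta> \<gamma> \<delta> \<in> H \<and> \<gamma> * p + \<delta> * r = r' * \<alpha> + s * \<gamma> / (x ^ M)\<^sup>2 \<and>
       cmod (\<alpha> * \<delta> - 1) \<le> 1 / 2 \<and>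
       (max (cmod \<alpha>) (cmod \<delta>))\<^sup>2 \<le> C * cmod x ^ M \<and>
       cmod \<gamma> \<le> C * max (cmod \<alpha>) (cmod \<delta>) \<and>
       cmod \<beta> \<le> C * cmod \<gamma> / (cmod x ^ M)\<^sup>2))"
proof -
  obtain C N where C: "C > 0" and N: "N > 0" and all: "\<forall>l \<alpha> \<beta> \<gamma> \<delta> \<mu>. cmod l \<ge> N \<longrightarrow>
     \<alpha> * \<delta> - \<beta> * \<gamma> = 1 \<longrightarrow>
     \<mu> = max (cmod \<alpha>) (cmod \<delta>) \<longrightarrow>
     mat2 \<alpha> \<beta> \<gamma> \<delta> ** mat2 (p * l) (q / l) (r * l) (s / l)
       = mat2 (p * l) (q' / l) (r' * l) (s / l) ** mat2 \<alpha> \<beta> \<gamma> \<delta> \<longrightarrow>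
     cmod \<gamma> \<le> C * \<mu> \<and> cmod \<beta> \<le> C * cmod \<gamma> / (cmod l)\<^sup>2 \<and>
     (\<mu> \<le> max (cmod (\<alpha> * (s / l) - \<beta> * (r * l))) (cmod (\<delta> * (p * l) - \<gamma> * (q / l))) \<longrightarrow>
      \<mu> \<le> max (cmod (\<alpha> * (p * l) + \<beta> * (r * l))) (cmod (\<gamma> * (q / l) + \<delta> * (s / l))) \<longrightarrow>
      cmod (\<alpha> * \<delta> - 1) \<le> 1 / 2 \<and> \<mu>\<^sup>2 \<le> C * cmod l)"
    using conjugator_bounds[OF p r, where s = s and q' = q' and r' = r' and q = q] by blast
  have bounds:
    "cmod l \<ge> N \<Longrightarrow> \<alpha> * \<delta> - \<beta> * \<gamma> = 1 \<Longrightarrow>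
       mat2 \<alpha> \<beta> \<gamma> \<delta> ** mat2 (p * l) (q / l) (r * l) (s / l)
         = mat2 (p * l) (q' / l) (r' * l) (s / l) ** mat2 \<alpha> \<beta> \<gamma> \<delta> \<Longrightarrow>
       cmod \<gamma> \<le> C * max (cmod \<alpha>) (cmod \<delta>) \<and> cmod \<beta> \<le> C * cmod \<gamma> / (cmod l)\<^sup>2 \<and>
       (max (cmod \<alpha>) (cmod \<delta>) \<le> max (cmod (\<alpha> * (s / l) - \<beta> * (r * l))) (cmod (\<delta> * (p * l) - \<gamma> * (q / l))) \<longrightarrow>
        max (cmod \<alpha>) (cmod \<delta>) \<le> max (cmod (\<alpha> * (p * l) + \<beta> * (r * l))) (cmod (\<gamma> * (q / l) + \<delta> * (s / l))) \<longrightarrow>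
        cmod (\<alpha> * \<delta> - 1) \<le> 1 / 2 \<and> (max (cmod \<alpha>) (cmod \<delta>))\<^sup>2 \<le> C * cmod l)"
    for l \<alpha> \<beta> \<gamma> \<delta>
    using all by blast
  obtain n where n: "\<And>M. M \<ge> n \<Longrightarrow> N < cmod x ^ M" using ex_power_gt by meson
  show ?thesis
  proof (rule exI[of _ C], rule exI[of _ n], intro conjI allI impI)
    show "C > 0" by (rule C)
    fix M
    assume M: "M \<ge> n" and ex: "\<exists>h\<in>H. h ** (mat2 p q r s ** mat2 (x ^ M) 0 0 (inverse (x ^ M)))
        = mat2 p q' r' s ** mat2 (x ^ M) 0 0 (inverse (x ^ M)) ** h"
    define l where "l = x ^ M"
    have nl: "cmod l = cmod x ^ M" by (simp add: l_def norm_power)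
    have l: "cmod l \<ge> N" "cmod l \<ge> 1" using n[OF M] norm_x by (simp_all add: nl)
    have l0: "l \<noteq> 0" using l(2) by auto
    define U V where "U = mat2 (p * l) (q / l) (r * l) (s / l)"
      and "V = mat2 (p * l) (q' / l) (r' * l) (s / l)"
    have UV: "mat2 p q r s ** mat2 (x ^ M) 0 0 (inverse (x ^ M)) = U"
      "mat2 p q' r' s ** mat2 (x ^ M) 0 0 (inverse (x ^ M)) = V"
      by (simp_all add: U_def V_def l_def divide_inverse)
    have U: "U \<in> H" using mult_H[OF u diag_power[of M]] unfolding UV .
    define D where "D = {h\<in>H. h ** U = V ** h}"
    define size where "size = (\<lambda>h :: complex^2^2. max (cmod (h $ 1 $ 1)) (cmod (h $ 2 $ 2)))"
    obtain h0 where h0: "h0 \<in> D" using ex unfolding UV D_def by blast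
    have D_bounds: "cmod \<gamma> \<le> C * max (cmod \<alpha>) (cmod \<delta>) \<and> cmod \<beta> \<le> C * cmod \<gamma> / (cmod l)\<^sup>2 \<and>
       (max (cmod \<alpha>) (cmod \<delta>) \<le> max (cmod (\<alpha> * (s / l) - \<beta> * (r * l))) (cmod (\<delta> * (p * l) - \<gamma> * (q / l))) \<longrightarrow>
        max (cmod \<alpha>) (cmod \<delta>) \<le> max (cmod (\<alpha> * (p * l) + \<beta> * (r * l))) (cmod (\<gamma> * (q / l) + \<delta> * (s / l))) \<longrightarrow>
        cmod (\<alpha> * \<delta> - 1) \<le> 1 / 2 \<and> (max (cmod \<alpha>) (cmod \<delta>))\<^sup>2 \<le> C * cmod l)"
      if "mat2 \<alpha> \<beta> \<gamma> \<delta> \<in> D" for \<alpha> \<beta> \<gamma> \<delta>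
    proof (rule bounds[OF l(1)])
      show "\<alpha> * \<delta> - \<beta> * \<gamma> = 1" using that mat2_H_det unfolding D_def by blast
      show "mat2 \<alpha> \<beta> \<gamma> \<delta> ** mat2 (p * l) (q / l) (r * l) (s / l)
         = mat2 (p * l) (q' / l) (r' * l) (s / l) ** mat2 \<alpha> \<beta> \<gamma> \<delta>"
        using that unfolding D_def U_def V_def by blast
    qed
    \<comment> \<open>discreteness: only finitely many conjugators are at most as large as a given one\<close>
    define B where "B = {h\<in>D. size h \<le> size h0}"
    define K where "K = size h0 + C * size h0 + C * (C * size h0)"
    have "B \<subseteq> H \<inter> {A :: complex^2^2. cmod (A $ 1 $ 1) \<le> K \<and> cmod (A $ 1 $ 2) \<le> K \<and>
       cmod (A $ 2 $ 1) \<le> K \<and> cmod (A $ 2 $ 2) \<le> K}"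
    proof
      fix h assume h: "h \<in> B"
      obtain \<alpha> \<beta> \<gamma> \<delta> where h_eq: "h = mat2 \<alpha> \<beta> \<gamma> \<delta>" by (rule mat2_cases)
      have sz: "max (cmod \<alpha>) (cmod \<delta>) \<le> size h0" using h by (simp add: B_def size_def h_eq)
      then have ad: "cmod \<alpha> \<le> size h0" "cmod \<delta> \<le> size h0" by simp_all
      then have s0: "0 \<le> size h0" using norm_ge_zero[of \<alpha>] by linarith
      have hD: "mat2 \<alpha> \<beta> \<gamma> \<delta> \<in> D" using h by (simp add: B_def h_eq)
      have "C * max (cmod \<alpha>) (cmod \<delta>) \<le> C * size h0" using sz C by simp
      then have g: "cmod \<gamma> \<le> C * size h0" using D_bounds[OF hD] by linarith
      have "C * cmod \<gamma> / (cmod l)\<^sup>2 \<le> C * cmod \<gamma>"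
        using l0 l(2) C divide_left_mono[of 1 "(cmod l)\<^sup>2" "C * cmod \<gamma>"] by (simp add: one_le_power)
      also have "\<dots> \<le> C * (C * size h0)" using g C by simp
      finally have b: "cmod \<beta> \<le> C * (C * size h0)" using D_bounds[OF hD] by linarith
      have "0 \<le> C * size h0" "0 \<le> C * (C * size h0)" using s0 C by simp_all
      then have "cmod \<alpha> \<le> K" "cmod \<beta> \<le> K" "cmod \<gamma> \<le> K" "cmod \<delta> \<le> K"
        using ad g b s0 unfolding K_def by linarith+
      moreover have "h \<in> H" using h by (simp add: B_def D_def)
      ultimately show "h \<in> H \<inter> {A :: complex^2^2. cmod (A $ 1 $ 1) \<le> K \<and> cmod (A $ 1 $ 2) \<le> K \<and>
         cmod (A $ 2 $ 1) \<le> K \<and> cmod (A $ 2 $ 2) \<le> K}" by (simp add: h_eq)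
    qed
    then have "finite B" using finite_bounded[OF bounded_mat2] finite_subset by blast
    moreover have "B \<noteq> {}" using h0 by (auto simp: B_def)
    ultimately obtain h where "is_arg_min size (\<lambda>h. h \<in> B) h"
      using ex_is_arg_min_if_finite by blast
    then have h: "h \<in> B" "\<And>k. k \<in> B \<Longrightarrow> size h \<le> size k"
      by (auto simp: is_arg_min_linorder)
    have hmin: "size h \<le> size k" if "k \<in> D" for k
      using h(2)[of k] h(1) that by (cases "size k \<le> size h0") (auto simp: B_def)
    have hD: "h \<in> D" using h(1) by (simp add: B_def)
    then have hU: "h ** U = V ** h" and hH: "h \<in> H" by (auto simp: D_def)
    have "h ** U ** U = V ** (h ** U)" by (simp add: hU flip: matrix_mul_assoc)
    then have up: "h ** U \<in> D" using mult_H[OF hH U] by (simp add: D_def)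
    have UU: "U ** adj2 U = mat 1" "adj2 U ** U = mat 1" using adj2_inverse det_H[OF U] by blast+
    have "h ** adj2 U ** U = V ** (h ** adj2 U)"
    proof -
      have "h ** adj2 U ** U = h" by (simp add: UU flip: matrix_mul_assoc)
      also have "h = h ** U ** adj2 U" by (simp add: UU flip: matrix_mul_assoc)
      also have "\<dots> = V ** (h ** adj2 U)" unfolding hU by (simp add: matrix_mul_assoc)
      finally show ?thesis .
    qed
    then have down: "h ** adj2 U \<in> D" using mult_H[OF hH adj2_H[OF U]] by (simp add: D_def)
    obtain \<alpha> \<beta> \<gamma> \<delta> where h_eq: "h = mat2 \<alpha> \<beta> \<gamma> \<delta>" by (rule mat2_cases)
    have size_h: "size h = max (cmod \<alpha>) (cmod \<delta>)" by (simp add: size_def h_eq)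
    have "max (cmod \<alpha>) (cmod \<delta>) \<le> max (cmod (\<alpha> * (s / l) - \<beta> * (r * l))) (cmod (\<delta> * (p * l) - \<gamma> * (q / l)))"
      using hmin[OF down] unfolding size_h by (simp add: size_def h_eq U_def del: times_divide_eq_right)
    moreover have "max (cmod \<alpha>) (cmod \<delta>) \<le> max (cmod (\<alpha> * (p * l) + \<beta> * (r * l))) (cmod (\<gamma> * (q / l) + \<delta> * (s / l)))"
      using hmin[OF up] unfolding size_h by (simp add: size_def h_eq U_def)
    moreover have "\<gamma> * p + \<delta> * r = r' * \<alpha> + s * \<gamma> / l\<^sup>2"
    proof -
      have "\<gamma> * (p * l) + \<delta> * (r * l) = r' * l * \<alpha> + s / l * \<gamma>"
        using hU by (simp add: h_eq U_def V_def)
      then show ?thesis using l0 by (simp add: field_simps power2_eq_square)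
    qed
    moreover note D_bounds[of \<alpha> \<beta> \<gamma> \<delta>]
    ultimately show "\<exists>\<alpha> \<beta> \<gamma> \<delta>. mat2 \<alpha> \<beta> \<gamma> \<delta> \<in> H \<and> \<gamma> * p + \<delta> * r = r' * \<alpha> + s * \<gamma> / (x ^ M)\<^sup>2 \<and>
       cmod (\<alpha> * \<delta> - 1) \<le> 1 / 2 \<and>
       (max (cmod \<alpha>) (cmod \<delta>))\<^sup>2 \<le> C * cmod x ^ M \<and>
       cmod \<gamma> \<le> C * max (cmod \<alpha>) (cmod \<delta>) \<and>
       cmod \<beta> \<le> C * cmod \<gamma> / (cmod x ^ M)\<^sup>2"
      using hD hH unfolding h_eq nl l_def[symmetric]
      by (intro exI[of _ \<alpha>] exI[of _ \<beta>] exI[of _ \<gamma>] exI[of _ \<delta>]) blast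
  qed
qed

text \<open>If \<open>u diag(x, 1/x)\<^sup>M\<close> and \<open>v diag(x, 1/x)\<^sup>M\<close> are conjugate in the group for infinitely many \<open>M\<close>, then some
  conjugator is diagonal, and a diagonal conjugator \<open>diag(a, 1/a)\<close> relates the lower left entries of
  \<open>u\<close> and \<open>v\<close> by the factor \<open>a\<^sup>2\<close>. If \<open>\<delta>\<close> rather than \<open>\<alpha>\<close> is the larger diagonal entry, the
  inverse of the conjugator takes its place.\<close>

lemma conjugate_translates:
  fixes I :: "nat set"
  assumes p: "p \<noteq> 0" and r: "r \<noteq> 0" and u: "mat2 p q r s \<in> H" and I: "infinite I"
    and conj: "\<And>M. M \<in> I \<Longrightarrow>
      \<exists>h\<in>H. h ** (mat2 p q r s ** mat2 (x ^ M) 0 0 (inverse (x ^ M)))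
        = mat2 p q' r' s ** mat2 (x ^ M) 0 0 (inverse (x ^ M)) ** h"
  shows "\<exists>a. mat2 a 0 0 (inverse a) \<in> H \<and> r = r' * a\<^sup>2"
proof -
  define good where "good C M \<alpha> \<beta> \<gamma> \<delta> \<longleftrightarrow> mat2 \<alpha> \<beta> \<gamma> \<delta> \<in> H \<and>
       \<gamma> * p + \<delta> * r = r' * \<alpha> + s * \<gamma> / (x ^ M)\<^sup>2 \<and>
       cmod (\<alpha> * \<delta> - 1) \<le> 1 / 2 \<and>
       (max (cmod \<alpha>) (cmod \<delta>))\<^sup>2 \<le> C * cmod x ^ M \<and>
       cmod \<gamma> \<le> C * max (cmod \<alpha>) (cmod \<delta>) \<and>
       cmod \<beta> \<le> C * cmod \<gamma> / (cmod x ^ M)\<^sup>2" for C M \<alpha> \<beta> \<gamma> \<delta>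
  obtain C n where C: "C > 0" and n: "\<And>M. M \<ge> n \<Longrightarrow> M \<in> I \<Longrightarrow> \<exists>\<alpha> \<beta> \<gamma> \<delta>. good C M \<alpha> \<beta> \<gamma> \<delta>"
    using ex_minimal_conjugator[OF p r u, of q' r', folded good_def] conj by blast
  then have "\<And>M. M \<in> I - {..<n} \<Longrightarrow> \<exists>\<alpha> \<beta> \<gamma> \<delta>. good C M \<alpha> \<beta> \<gamma> \<delta>" by simp
  then obtain \<alpha> \<beta> \<gamma> \<delta> where good: "\<And>M. M \<in> I - {..<n} \<Longrightarrow> good C M (\<alpha> M) (\<beta> M) (\<gamma> M) (\<delta> M)"
    by metis
  have
    H: "\<And>M. M \<in> I - {..<n} \<Longrightarrow> mat2 (\<alpha> M) (\<beta> M) (\<gamma> M) (\<delta> M) \<in> H"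
    and e: "\<And>M. M \<in> I - {..<n} \<Longrightarrow> \<gamma> M * p + \<delta> M * r = r' * \<alpha> M + s * \<gamma> M / (x ^ M)\<^sup>2"
    and 1: "\<And>M. M \<in> I - {..<n} \<Longrightarrow> cmod (\<alpha> M * \<delta> M - 1) \<le> 1 / 2"
    and 2: "\<And>M. M \<in> I - {..<n} \<Longrightarrow> (max (cmod (\<alpha> M)) (cmod (\<delta> M)))\<^sup>2 \<le> C * cmod x ^ M"
    and 3: "\<And>M. M \<in> I - {..<n} \<Longrightarrow> cmod (\<gamma> M) \<le> C * max (cmod (\<alpha> M)) (cmod (\<delta> M))"
    and 4: "\<And>M. M \<in> I - {..<n} \<Longrightarrow> cmod (\<beta> M) \<le> C * cmod (\<gamma> M) / (cmod x ^ M)\<^sup>2"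
    using good unfolding good_def by blast+
  define I1 where "I1 = {M \<in> I - {..<n}. cmod (\<delta> M) \<le> cmod (\<alpha> M)}"
  define I2 where "I2 = {M \<in> I - {..<n}. cmod (\<alpha> M) \<le> cmod (\<delta> M)}"
  have I12: "I1 \<subseteq> I - {..<n}" "I2 \<subseteq> I - {..<n}" by (auto simp: I1_def I2_def)
  have m1: "max (cmod (\<alpha> M)) (cmod (\<delta> M)) = cmod (\<alpha> M)" if "M \<in> I1" for M
    using that by (simp add: I1_def)
  have m2: "max (cmod (\<alpha> M)) (cmod (\<delta> M)) = cmod (\<delta> M)" if "M \<in> I2" for M
    using that by (simp add: I2_def)
  have "I - {..<n} = I1 \<union> I2" by (auto simp: I1_def I2_def)
  moreover have "infinite (I - {..<n})" using I by simp
  ultimately have "infinite I1 \<or> infinite I2" by (metis finite_UnI)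
  then obtain M where M: "M \<in> I - {..<n}" "\<beta> M = 0" "\<gamma> M = 0"
  proof
    assume inf: "infinite I1"
    have "\<exists>M\<in>I1. \<beta> M = 0 \<and> \<gamma> M = 0"
    proof (rule conjugator_diagonal[OF inf C])
      fix M assume M: "M \<in> I1"
      then have M': "M \<in> I - {..<n}" using I12 by blast
      show "mat2 (\<alpha> M) (\<beta> M) (\<gamma> M) (\<delta> M) \<in> H" by (rule H[OF M'])
      show "cmod (\<delta> M) \<le> cmod (\<alpha> M)" using M by (simp add: I1_def)
      show "cmod (\<alpha> M * \<delta> M - 1) \<le> 1 / 2" by (rule 1[OF M'])
      show "(cmod (\<alpha> M))\<^sup>2 \<le> C * cmod x ^ M" using 2[OF M'] unfolding m1[OF M] .
      show "cmod (\<gamma> M) \<le> C * cmod (\<alpha> M)" using 3[OF M'] unfolding m1[OF M] .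
      show "cmod (\<beta> M) \<le> C * cmod (\<gamma> M) / (cmod x ^ M)\<^sup>2" by (rule 4[OF M'])
    qed
    then show ?thesis using that I12 by blast
  next
    assume inf: "infinite I2"
    have "\<exists>M\<in>I2. - \<beta> M = 0 \<and> - \<gamma> M = 0"
    proof (rule conjugator_diagonal[OF inf C])
      fix M assume M: "M \<in> I2"
      then have M': "M \<in> I - {..<n}" using I12 by blast
      show "mat2 (\<delta> M) (- \<beta> M) (- \<gamma> M) (\<alpha> M) \<in> H" using adj2_H[OF H[OF M']] by simp
      show "cmod (\<alpha> M) \<le> cmod (\<delta> M)" using M by (simp add: I2_def)
      show "cmod (\<delta> M * \<alpha> M - 1) \<le> 1 / 2" using 1[OF M'] by (simp add: mult.commute)
      show "(cmod (\<delta> M))\<^sup>2 \<le> C * cmod x ^ M" using 2[OF M'] unfolding m2[OF M] .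
      show "cmod (- \<gamma> M) \<le> C * cmod (\<delta> M)" using 3[OF M'] unfolding m2[OF M] by simp
      show "cmod (- \<beta> M) \<le> C * cmod (- \<gamma> M) / (cmod x ^ M)\<^sup>2" using 4[OF M'] by simp
    qed
    then show ?thesis using that I12 by auto
  qed
  have h: "mat2 (\<alpha> M) 0 0 (\<delta> M) \<in> H" using H[OF M(1)] M by simp
  then have ad: "\<alpha> M * \<delta> M = 1" using mat2_H_det by fastforce
  then have d: "\<delta> M = inverse (\<alpha> M)" by (metis inverse_unique)
  have "\<delta> M * r = r' * \<alpha> M" using e[OF M(1)] M by simp
  then have "\<alpha> M * \<delta> M * r = r' * (\<alpha> M)\<^sup>2" by (simp add: power2_eq_square mult_ac)
  then show ?thesis using h ad d by auto
qed

end

section \<open>Elements with equal diagonals\<close>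

text \<open>Exchanging \<open>(a, a')\<close> with \<open>(b, b')\<close> reverses the word on the left. It leaves the diagonal of the product
  unchanged, but not the lower left entry.\<close>

lemma word_matrix:
  "mat2 p q r s ** mat2 a 0 0 a' ** mat2 p q r s ** mat2 b 0 0 b' ** mat2 p q r s =
     mat2 (p ^ 3 * (a * b) + p * (q * r) * (a * b' + a' * b) + (q * r) * s * (a' * b'))
       (q * (p\<^sup>2 * (a * b) + q * r * (a' * b) + p * s * (a * b') + s\<^sup>2 * (a' * b')))
       (r * (p\<^sup>2 * (a * b) + q * r * (a * b') + p * s * (a' * b) + s\<^sup>2 * (a' * b')))
       (p * (q * r) * (a * b) + (q * r) * s * (a * b' + a' * b) + s ^ 3 * (a' * b'))"
  by (simp add: algebra_simps power2_eq_square power3_eq_cube)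

context nonelementary_discrete
begin

text \<open>If \<open>a\<^sup>2\<close> is close to 1 then \<open>a\<close> and its inverse are bounded, so discreteness leaves only finitely
  many such elements.\<close>

lemma diagonal_isolated:
  "\<exists>e>0. \<forall>a. mat2 a 0 0 (inverse a) \<in> H \<longrightarrow> cmod (a\<^sup>2 - 1) < e \<longrightarrow> a\<^sup>2 = 1"
proof -
  define S where "S = {a. mat2 a 0 0 (inverse a) \<in> H \<and> cmod (a\<^sup>2 - 1) \<le> 1 / 2}"
  have "S \<subseteq> (\<lambda>A. A $ 1 $ 1) ` (H \<inter> {A. cmod (A $ 1 $ 1) \<le> 2 \<and> cmod (A $ 1 $ 2) \<le> 2 \<and>
     cmod (A $ 2 $ 1) \<le> 2 \<and> cmod (A $ 2 $ 2) \<le> 2})"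
  proof
    fix a assume a: "a \<in> S"
    have "cmod (a\<^sup>2) \<le> 3 / 2" "1 / 2 \<le> cmod (a\<^sup>2)"
      using a norm_triangle_ineq2[of "a\<^sup>2" 1] norm_triangle_ineq2[of 1 "1 - a\<^sup>2"]
      by (simp_all add: S_def norm_minus_commute)
    then have "(cmod a)\<^sup>2 \<le> 2\<^sup>2" "(1 / 2)\<^sup>2 \<le> (cmod a)\<^sup>2"
      unfolding norm_power by (simp_all add: power_divide)
    then have 2: "cmod a \<le> 2" "1 / 2 \<le> cmod a"
      by (metis power2_le_imp_le zero_le_numeral, metis power2_le_imp_le norm_ge_zero)
    moreover have "cmod (inverse a) \<le> 2"
      using le_imp_inverse_le[OF 2(2)] by (simp add: norm_inverse)
    ultimately show "a \<in> (\<lambda>A. A $ 1 $ 1) ` (H \<inter> {A. cmod (A $ 1 $ 1) \<le> 2 \<and> cmod (A $ 1 $ 2) \<le> 2 \<and>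
     cmod (A $ 2 $ 1) \<le> 2 \<and> cmod (A $ 2 $ 2) \<le> 2})"
      using a by (intro image_eqI[of _ _ "mat2 a 0 0 (inverse a)"]) (auto simp: S_def)
  qed
  then have "finite S" using finite_bounded[OF bounded_mat2[of 2]] finite_subset by blast
  define T where "T = insert (1 / 2) ((\<lambda>a. cmod (a\<^sup>2 - 1)) ` S - {0})"
  have T: "finite T" "T \<noteq> {}" using \<open>finite S\<close> by (simp_all add: T_def)
  have pos: "Min T > 0" using T by (auto simp: T_def)
  have "a\<^sup>2 = 1" if a: "mat2 a 0 0 (inverse a) \<in> H" "cmod (a\<^sup>2 - 1) < Min T" for a
  proof (rule ccontr)
    assume ne: "a\<^sup>2 \<noteq> 1"
    have "Min T \<le> 1 / 2" using T by (intro Min_le) (auto simp: T_def)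
    then have "a \<in> S" using a by (simp add: S_def)
    then have "cmod (a\<^sup>2 - 1) \<in> T" using ne by (auto simp: T_def)
    then have "Min T \<le> cmod (a\<^sup>2 - 1)" using T by simp
    then show False using a(2) by simp
  qed
  with pos show ?thesis by blast
qed

end

context diagonal_loxodromic
begin

lemma upper_right_entry: "mat2 a b c d \<in> H \<Longrightarrow> c \<noteq> 0 \<Longrightarrow> b = (a * d - 1) / c"
  using mat2_H_det[of a b c d] by (simp add: field_simps)

text \<open>Induction on the number of elements. Let \<open>b = diag(x, 1/x)\<close>, let \<open>R\<close> be the set of lower left entries of the
  elements \<open>u\<close> found so far, and let \<open>u\<^sub>0\<close> be one of them. Replace every \<open>u\<close> by
  \<open>u b\<^sup>l\<^sup>+\<^sup>1 u b\<^sup>l u\<close>; this multiplies all lower left entries by the same factor \<open>F\<close>. Add the reversed word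
  \<open>u\<^sub>0 b\<^sup>l u\<^sub>0 b\<^sup>l\<^sup>+\<^sup>1 u\<^sub>0\<close>, which has the same diagonal again but lower left entry \<open>r\<^sub>0 F'\<close>. The
  quotient \<open>F' / F\<close> differs from 1, because \<open>F - F'\<close> is \<open>1 / x - x\<close>, and tends to 1 as \<open>l\<close> grows, because \<open>F\<close> tends to infinity.
  So for large \<open>l\<close> the new entry is distinct from the others and all ratios stay close to 1. The
  upper right entry is expressed by the others through the determinant.\<close>

lemma equal_diagonals:
  assumes e: "e > 0"
  shows "\<exists>p s R. p \<noteq> 0 \<and> finite R \<and> card R = Suc n \<and> 0 \<notin> R \<and>
     (\<forall>r\<in>R. mat2 p ((p * s - 1) / r) r s \<in> H) \<and> (\<forall>r\<in>R. \<forall>r'\<in>R. cmod (r / r' - 1) < e)"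
proof (induction n)
  case 0
  obtain p q r s where A: "mat2 p q r s \<in> H" "p \<noteq> 0" "r \<noteq> 0" using moves_infinity by blast
  then have "mat2 p ((p * s - 1) / r) r s \<in> H" using upper_right_entry by metis
  with A e show ?case by (intro exI[of _ p] exI[of _ s] exI[of _ "{r}"]) simp
next
  case (Suc n)
  then obtain p s R where p: "p \<noteq> 0" and R: "finite R" "card R = Suc n" "0 \<notin> R"
    and H: "\<And>r. r \<in> R \<Longrightarrow> mat2 p ((p * s - 1) / r) r s \<in> H"
    and ratio: "\<And>r r'. r \<in> R \<Longrightarrow> r' \<in> R \<Longrightarrow> cmod (r / r' - 1) < e" by blast
  obtain r0 where r0: "r0 \<in> R" using R(2) by (metis card.empty ex_in_conv nat.distinct(1))
  have Rne: "r \<noteq> 0" if "r \<in> R" for r using that R(3) by blast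
  \<comment> \<open>\<open>F\<close>, \<open>F'\<close> and the upper left entry of the words, divided by their leading power \<open>x ^ (2 * l + 1)\<close>, are
    polynomials in \<open>w = x ^ - (2 * l + 1)\<close>\<close>
  define D where "D = p * s - 1"
  define w where "w l = inverse (x ^ Suc (2 * l))" for l
  define f where "f w = p\<^sup>2 + D * (x * w) + p * s * (inverse x * w) + s\<^sup>2 * (w * w)" for w
  define f' where "f' w = p\<^sup>2 + D * (inverse x * w) + p * s * (x * w) + s\<^sup>2 * (w * w)" for w
  define P where "P w = p ^ 3 + p * D * ((x + inverse x) * w) + D * s * (w * w)" for w
  define g where "g l = f' (w l) / f (w l)" for l
  have w: "w \<longlonglongrightarrow> 0"
  proof -
    have "(\<lambda>l. (inverse x) ^ l) \<longlonglongrightarrow> 0"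
      using norm_x by (intro LIMSEQ_power_zero) (simp add: norm_inverse inverse_less_1_iff)
    then have "((\<lambda>l. (inverse x) ^ l) \<circ> (\<lambda>l. Suc (2 * l))) \<longlonglongrightarrow> 0"
      by (rule LIMSEQ_subseq_LIMSEQ) (simp add: strict_mono_def)
    then show ?thesis by (simp add: w_def[abs_def] comp_def power_inverse)
  qed
  have lim: "(\<lambda>l. f (w l)) \<longlonglongrightarrow> p\<^sup>2" "(\<lambda>l. f' (w l)) \<longlonglongrightarrow> p\<^sup>2" "(\<lambda>l. P (w l)) \<longlonglongrightarrow> p ^ 3"
    unfolding f_def f'_def P_def by (rule tendsto_eq_intros w refl | simp)+
  have g: "g \<longlonglongrightarrow> 1"
    unfolding g_def using tendsto_divide[OF lim(2,1)] p by simp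
  have ev: "\<forall>\<^sub>F l in sequentially. f (w l) \<noteq> 0" "\<forall>\<^sub>F l in sequentially. f' (w l) \<noteq> 0"
    "\<forall>\<^sub>F l in sequentially. P (w l) \<noteq> 0"
    using lim p by (auto intro: tendsto_imp_eventually_ne)
  have ev_R: "\<forall>\<^sub>F l in sequentially. (r \<noteq> r0 \<longrightarrow> r0 * g l \<noteq> r) \<and>
      cmod (r0 * g l / r - 1) < e \<and> cmod (r / (r0 * g l) - 1) < e" if r: "r \<in> R" for r
  proof -
    have "\<forall>\<^sub>F l in sequentially. r \<noteq> r0 \<longrightarrow> r0 * g l \<noteq> r"
    proof (cases "r = r0")
      case False
      have "(\<lambda>l. r0 * g l) \<longlonglongrightarrow> r0" using tendsto_mult_left[OF g, of r0] by simp
      then have "\<forall>\<^sub>F l in sequentially. r0 * g l \<noteq> r"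
        using False by (intro tendsto_imp_eventually_ne) auto
      then show ?thesis by (rule eventually_mono) simp
    qed simp
    moreover have "(\<lambda>l. cmod (r0 * g l / r - 1)) \<longlonglongrightarrow> cmod (r0 * 1 / r - 1)"
      using g Rne[OF r] by (intro tendsto_intros) auto
    then have "\<forall>\<^sub>F l in sequentially. cmod (r0 * g l / r - 1) < e"
      using ratio[OF r0 r] by (intro order_tendstoD(2)) simp_all
    moreover have "(\<lambda>l. cmod (r / (r0 * g l) - 1)) \<longlonglongrightarrow> cmod (r / (r0 * 1) - 1)"
      using g Rne[OF r0] by (intro tendsto_intros) auto
    then have "\<forall>\<^sub>F l in sequentially. cmod (r / (r0 * g l) - 1) < e"
      using ratio[OF r r0] by (intro order_tendstoD(2)) simp_all
    ultimately show ?thesis by eventually_elim simp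
  qed
  have "\<forall>\<^sub>F l in sequentially. f (w l) \<noteq> 0 \<and> f' (w l) \<noteq> 0 \<and> P (w l) \<noteq> 0 \<and>
     (\<forall>r\<in>R. (r \<noteq> r0 \<longrightarrow> r0 * g l \<noteq> r) \<and>
      cmod (r0 * g l / r - 1) < e \<and> cmod (r / (r0 * g l) - 1) < e)"
    by (intro eventually_conj ev eventually_ball_finite R(1) ballI ev_R)
  then obtain l where l: "f (w l) \<noteq> 0" "f' (w l) \<noteq> 0" "P (w l) \<noteq> 0"
    and lR: "\<And>r. r \<in> R \<Longrightarrow> r \<noteq> r0 \<Longrightarrow> r0 * g l \<noteq> r"
      "\<And>r. r \<in> R \<Longrightarrow> cmod (r0 * g l / r - 1) < e"
      "\<And>r. r \<in> R \<Longrightarrow> cmod (r / (r0 * g l) - 1) < e"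
    using eventually_happens'[OF sequentially_bot] by blast
  define y where "y = x ^ Suc (2 * l)"
  have y0: "y \<noteq> 0" using x0 by (simp add: y_def)
  have yw1: "y * w l = 1" using y0 by (simp add: w_def y_def[symmetric] del: power_Suc)
  then have yw: "y * (w l * z) = z" "y * (z * w l) = z" for z
    by (simp_all add: mult_ac)
  define F F' where "F = y * f (w l)" and "F' = y * f' (w l)"
  have F: "F = p\<^sup>2 * y + D * x + p * s * inverse x + s\<^sup>2 * w l"
    "F' = p\<^sup>2 * y + D * inverse x + p * s * x + s\<^sup>2 * w l"
    "y * P (w l) = p ^ 3 * y + p * D * (x + inverse x) + D * s * w l"
    by (simp_all add: F_def F'_def f_def f'_def P_def algebra_simps yw yw1)
  have F0: "F \<noteq> 0" "F' \<noteq> 0" "y * P (w l) \<noteq> 0" using l y0 by (simp_all add: F_def F'_def)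
  have F'F: "F' = g l * F" using l y0 by (simp add: F_def F'_def g_def)
  have "F - F' = - (x - inverse x)" unfolding F D_def by (simp add: algebra_simps)
  moreover have "x \<noteq> inverse x"
  proof
    assume "x = inverse x"
    then have "cmod x = inverse (cmod x)" by (metis norm_inverse)
    then show False using norm_x inverse_less_1_iff[of "cmod x"] by simp
  qed
  ultimately have g1: "g l \<noteq> 1" using F'F by auto
  define Q where "Q = p * D * y + D * s * (x + inverse x) + s ^ 3 * w l"
  have pow: "x ^ Suc l * x ^ l = y" "x ^ Suc l * inverse (x ^ l) = x"
    "inverse (x ^ Suc l) * x ^ l = inverse x" "inverse (x ^ Suc l) * inverse (x ^ l) = w l"
    "x ^ l * x ^ Suc l = y" "x ^ l * inverse (x ^ Suc l) = inverse x"
    "inverse (x ^ l) * x ^ Suc l = x" "inverse (x ^ l) * inverse (x ^ Suc l) = w l"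
    using x0 by (simp_all add: y_def w_def mult_2 power_add)
  \<comment> \<open>the two words, which are reversals of each other\<close>
  have words: "mat2 (y * P (w l)) ((y * P (w l) * Q - 1) / (r * F)) (r * F) Q \<in> H"
    "mat2 (y * P (w l)) ((y * P (w l) * Q - 1) / (r * F')) (r * F') Q \<in> H" if r: "r \<in> R" for r
  proof -
    define A where "A = mat2 p (D / r) r s"
    have A: "A \<in> H" using H[OF r] by (simp add: A_def D_def)
    have D: "(D / r) * r = D" using Rne[OF r] by simp
    have "A ** mat2 (x ^ Suc l) 0 0 (inverse (x ^ Suc l)) ** A ** mat2 (x ^ l) 0 0 (inverse (x ^ l)) ** A \<in> H"
      "A ** mat2 (x ^ l) 0 0 (inverse (x ^ l)) ** A ** mat2 (x ^ Suc l) 0 0 (inverse (x ^ Suc l)) ** A \<in> H"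
      by (intro mult_H A diag_power)+
    then obtain b b' where "mat2 (y * P (w l)) b (r * F) Q \<in> H" "mat2 (y * P (w l)) b' (r * F') Q \<in> H"
      unfolding A_def word_matrix pow D F Q_def by (simp add: add_ac mult_ac)
    then show "mat2 (y * P (w l)) ((y * P (w l) * Q - 1) / (r * F)) (r * F) Q \<in> H"
      "mat2 (y * P (w l)) ((y * P (w l) * Q - 1) / (r * F')) (r * F') Q \<in> H"
      using upper_right_entry[of "y * P (w l)" b "r * F" Q] upper_right_entry[of "y * P (w l)" b' "r * F'" Q]
        F0 Rne[OF r] by simp_all
  qed
  define R' where "R' = insert (r0 * F') ((\<lambda>r. r * F) ` R)"
  have "r0 * F' \<notin> (\<lambda>r. r * F) ` R"
  proof
    assume "r0 * F' \<in> (\<lambda>r. r * F) ` R"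
    then obtain r where r: "r \<in> R" "r0 * g l * F = r * F" by (auto simp: F'F mult.assoc)
    then have eq: "r0 * g l = r" using F0 by simp
    then have "r = r0" using lR(1)[OF r(1)] by blast
    then show False using eq g1 Rne[OF r0] by simp
  qed
  moreover have "inj_on (\<lambda>r. r * F) R" using F0 by (simp add: inj_on_def)
  ultimately have "card R' = Suc (Suc n)" using R by (simp add: R'_def card_image)
  moreover have "finite R'" "0 \<notin> R'" using R F0 r0 by (auto simp: R'_def)
  moreover have "\<forall>r\<in>R'. mat2 (y * P (w l)) ((y * P (w l) * Q - 1) / r) r Q \<in> H"
    using words r0 by (auto simp: R'_def)
  moreover have "\<forall>r\<in>R'. \<forall>r'\<in>R'. cmod (r / r' - 1) < e"
  proof -
    have "cmod (r * F / (r' * F) - 1) < e" if "r \<in> R" "r' \<in> R" for r r'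
      using ratio[OF that] F0 by simp
    moreover have "cmod (r0 * F' / (r * F) - 1) < e" "cmod (r * F / (r0 * F') - 1) < e" if "r \<in> R" for r
    proof -
      have "r0 * F' / (r * F) = r0 * g l / r" "r * F / (r0 * F') = r / (r0 * g l)"
        using F0 by (simp_all add: F'F)
      then show "cmod (r0 * F' / (r * F) - 1) < e" "cmod (r * F / (r0 * F') - 1) < e"
        using lR(2,3)[OF that] by simp_all
    qed
    moreover have "cmod (r0 * F' / (r0 * F') - 1) < e" using F0 Rne[OF r0] e by simp
    ultimately show ?thesis unfolding R'_def by blast
  qed
  ultimately show ?case using F0 by blast
qed

text \<open>For each pair of elements with equal diagonals only finitely many exponents \<open>M\<close> give conjugate products
  with \<open>diag(x, 1/x)\<^sup>M\<close>, so one exponent serves all pairs. Conjugacy up to sign is excluded as well, since it would negate the trace; this is what conjugacy in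
  PSL(2,C) amounts to.\<close>

lemma many_nonconjugate_diagonal:
  "\<exists>W t. finite W \<and> card W = Suc n \<and> W \<subseteq> H \<and> cmod t > 2 \<and> (\<forall>A\<in>W. trace A = t) \<and>
     (\<forall>A\<in>W. \<forall>B\<in>W. A \<noteq> B \<longrightarrow> (\<forall>h\<in>H. h ** A \<noteq> B ** h \<and> h ** A \<noteq> - (B ** h)))"
proof -
  obtain e where e: "e > 0"
    "\<And>a. mat2 a 0 0 (inverse a) \<in> H \<Longrightarrow> cmod (a\<^sup>2 - 1) < e \<Longrightarrow> a\<^sup>2 = 1"
    using diagonal_isolated by blast
  obtain p s R where p: "p \<noteq> 0" and R: "finite R" "card R = Suc n" "0 \<notin> R"
    and H: "\<And>r. r \<in> R \<Longrightarrow> mat2 p ((p * s - 1) / r) r s \<in> H"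
    and ratio: "\<And>r r'. r \<in> R \<Longrightarrow> r' \<in> R \<Longrightarrow> cmod (r / r' - 1) < e"
    using equal_diagonals[OF e(1), of n] by blast
  define u where "u r M = mat2 p ((p * s - 1) / r) r s ** mat2 (x ^ M) 0 0 (inverse (x ^ M))" for r M
  have u_entries: "u r M = mat2 (p * x ^ M) ((p * s - 1) / r * inverse (x ^ M)) (r * x ^ M) (s * inverse (x ^ M))" for r M
    by (simp add: u_def)
  have uH: "u r M \<in> H" if "r \<in> R" for r M
    unfolding u_def by (intro mult_H H that diag_power)
  have fin: "finite {M. \<exists>h\<in>H. h ** u r M = u r' M ** h}" if r: "r \<in> R" "r' \<in> R" "r \<noteq> r'" for r r'
  proof (rule ccontr)
    assume "infinite {M. \<exists>h\<in>H. h ** u r M = u r' M ** h}"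
    then obtain a where a: "mat2 a 0 0 (inverse a) \<in> H" "r = r' * a\<^sup>2"
      using conjugate_translates[OF p _ H[OF r(1)], of "{M. \<exists>h\<in>H. h ** u r M = u r' M ** h}" "(p * s - 1) / r'" r']
        r(1) R(3) unfolding u_def by blast
    have "r' \<noteq> 0" using r R(3) by blast
    then have "a\<^sup>2 = r / r'" using a(2) by simp
    then have "a\<^sup>2 = 1" using e(2)[OF a(1)] ratio[OF r(1,2)] by simp
    then show False using a(2) r(3) by simp
  qed
  define B where "B = (\<Union>r\<in>R. \<Union>r'\<in>R - {r}. {M. \<exists>h\<in>H. h ** u r M = u r' M ** h})"
  have "finite B" unfolding B_def using R(1) fin by blast
  obtain n0 where n0: "\<And>M. M \<ge> n0 \<Longrightarrow> (2 + cmod s) / cmod p < cmod x ^ M"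
    using ex_power_gt by meson
  have "infinite ({n0..} - B)" using \<open>finite B\<close> infinite_Ici by (simp add: Diff_infinite_finite)
  then obtain M where M: "M \<ge> n0" "M \<notin> B" using infinite_imp_nonempty by blast
  define t where "t = p * x ^ M + s * inverse (x ^ M)"
  have tr: "trace (u r M) = t" for r by (simp add: u_entries t_def)
  have t: "cmod t > 2"
  proof -
    have "2 + cmod s < cmod (p * x ^ M)"
      using n0[OF M(1)] p by (simp add: pos_divide_less_eq norm_mult norm_power mult.commute)
    moreover have "cmod (s * inverse (x ^ M)) \<le> cmod s"
    proof -
      have "inverse (cmod x ^ M) \<le> 1" using norm_x by (simp add: inverse_le_1_iff)
      then show ?thesis
        using mult_left_mono[of "inverse (cmod x ^ M)" 1 "cmod s"] by (simp add: norm_mult norm_inverse norm_power)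
    qed
    ultimately show ?thesis
      using norm_diff_ineq[of "p * x ^ M" "s * inverse (x ^ M)"] unfolding t_def by linarith
  qed
  define W where "W = (\<lambda>r. u r M) ` R"
  have inj: "inj_on (\<lambda>r. u r M) R" using x0 by (auto simp: inj_on_def u_entries)
  have "h ** A \<noteq> B' ** h \<and> h ** A \<noteq> - (B' ** h)"
    if AB: "A \<in> W" "B' \<in> W" "A \<noteq> B'" and h: "h \<in> H" for A B' h
  proof -
    obtain r r' where r: "r \<in> R" "A = u r M" "r' \<in> R" "B' = u r' M" using AB by (auto simp: W_def)
    have ne: "r \<noteq> r'" using AB r by blast
    have "h ** A \<noteq> B' ** h" using M(2) r ne h unfolding B_def by blast
    moreover have "h ** A \<noteq> - (B' ** h)"
    proof
      assume eq: "h ** A = - (B' ** h)"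
      have hh: "h ** adj2 h = mat 1" "adj2 h ** h = mat 1" using adj2_inverse det_H[OF h] by blast+
      have "trace A = trace (adj2 h ** (h ** A))"
        by (simp add: hh matrix_mul_assoc)
      also have "\<dots> = - trace (adj2 h ** (B' ** h))"
        unfolding eq by (simp add: matrix_mul_uminus_right trace_2)
      also have "\<dots> = - trace B'" using trace_conj_SL2C[OF hh(2)] by simp
      finally have "t = - t" using tr r by simp
      then have "t = 0" by simp
      then show False using t by simp
    qed
    ultimately show ?thesis ..
  qed
  moreover have "finite W" "card W = Suc n" "W \<subseteq> H" "\<forall>A\<in>W. trace A = t"
    using R inj uH tr by (auto simp: W_def card_image)
  ultimately show ?thesis using t by blast
qed

end

context nonelementary_discrete
begin

text \<open>Conjugating a loxodromic element to diagonal form changes neither traces nor conjugacy.\<close>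

lemma many_nonconjugate:
  "\<exists>W t. finite W \<and> card W = Suc n \<and> W \<subseteq> H \<and> cmod t > 2 \<and> (\<forall>A\<in>W. trace A = t) \<and>
     (\<forall>A\<in>W. \<forall>B\<in>W. A \<noteq> B \<longrightarrow> (\<forall>h\<in>H. h ** A \<noteq> B ** h \<and> h ** A \<noteq> - (B ** h)))"
proof -
  obtain A where A: "A \<in> H" "cmod (trace A) > 2" using exists_trace_gt_2 by blast
  have "(trace A)\<^sup>2 \<noteq> 4"
  proof
    assume "(trace A)\<^sup>2 = 4"
    then have "(trace A)\<^sup>2 = 2\<^sup>2" by simp
    then have "trace A = 2 \<or> trace A = - 2" by (simp only: power2_eq_iff)
    then show False using A(2) by auto
  qed
  then obtain G x where G: "det G = 1" "adj2 G ** A ** G = mat2 x 0 0 (inverse x)" "x \<noteq> 0"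
    using diagonalise det_H[OF A(1)] by blast
  define f where "f = (\<lambda>A. adj2 G ** A ** G)"
  interpret C: nonelementary_discrete "f ` H"
    unfolding f_def by (rule nonelementary_discrete_conj[OF G(1)])
  have tr_f: "trace (f B) = trace B" for B
    using trace_conj_SL2C[OF adj2_inverse(2)[OF G(1)], of B] by (simp add: f_def matrix_mul_assoc)
  have "f A = mat2 x 0 0 (inverse x)" using G(2) by (simp add: f_def)
  then have X: "mat2 x 0 0 (inverse x) \<in> f ` H" and "trace A = x + inverse x"
    using A(1) tr_f[of A] by (metis imageI, simp)
  have "cmod x \<noteq> 1"
  proof
    assume "cmod x = 1"
    then have "cmod (x + inverse x) \<le> 2" using norm_triangle_ineq[of x "inverse x"] by (simp add: norm_inverse)
    then show False using A(2) \<open>trace A = x + inverse x\<close> by simp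
  qed
  obtain z where z: "cmod z > 1" "mat2 z 0 0 (inverse z) \<in> f ` H"
  proof (cases "cmod x > 1")
    case True
    then show ?thesis using that X by blast
  next
    case False
    then have "cmod (inverse x) > 1" using \<open>cmod x \<noteq> 1\<close> G(3) by (simp add: norm_inverse one_less_inverse_iff)
    moreover have "mat2 (inverse x) 0 0 (inverse (inverse x)) \<in> f ` H" using C.adj2_H[OF X] by simp
    ultimately show ?thesis using that by blast
  qed
  interpret L: diagonal_loxodromic "f ` H" z
    by (intro diagonal_loxodromic.intro diagonal_loxodromic_axioms.intro C.nonelementary_discrete_axioms z)
  obtain W t where W: "finite W" "card W = Suc n" "W \<subseteq> f ` H" "cmod t > 2" "\<forall>A\<in>W. trace A = t"
    and nonconj: "\<forall>A\<in>W. \<forall>B\<in>W. A \<noteq> B \<longrightarrow> (\<forall>h\<in>f ` H. h ** A \<noteq> B ** h \<and> h ** A \<noteq> - (B ** h))"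
    using L.many_nonconjugate_diagonal[of n] by (elim exE conjE) (rule that)
  have cancel: "G ** (adj2 G ** X) = X" for X
    by (simp add: adj2_inverse[OF G(1)] matrix_mul_assoc)
  have f_mult: "f (A ** B) = f A ** f B" for A B
    by (simp add: f_def cancel flip: matrix_mul_assoc)
  have f_uminus: "f (- A) = - f A" for A
    by (simp add: f_def matrix_mul_uminus_left matrix_mul_uminus_right)
  obtain V where V: "V \<subseteq> H" "inj_on f V" "f ` V = W" using W(3) by (metis subset_image_inj)
  have "finite V" "card V = Suc n" using V W(1,2) by (metis finite_imageD, metis card_image)
  moreover have "trace B = t" if "B \<in> V" for B
  proof -
    have "trace (f B) = t" using W(5) V(3) that by blast
    then show ?thesis by (simp add: tr_f)
  qed
  moreover have "h ** B \<noteq> B' ** h \<and> h ** B \<noteq> - (B' ** h)"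
    if B: "B \<in> V" "B' \<in> V" "B \<noteq> B'" and h: "h \<in> H" for B B' h
  proof -
    have "f h ** f B \<noteq> f B' ** f h \<and> f h ** f B \<noteq> - (f B' ** f h)"
    proof (rule nonconj[rule_format])
      show "f B \<noteq> f B'" using B V(2) by (meson inj_onD)
      show "f B \<in> W" "f B' \<in> W" "f h \<in> f ` H" using B h V(3) by blast+
    qed
    then show ?thesis by (metis f_mult f_uminus)
  qed
  ultimately show ?thesis using V(1) W(4) by blast
qed

end

section \<open>From Kleinian groups to matrix groups\<close>

lemma coset_mult:
  assumes "det A = 1" "det B = 1"
  shows "{A, - A} \<otimes>\<^bsub>PSL2C\<^esub> {B, - B} = {A ** B, - (A ** B)}"
  unfolding PSL2C_def FactGroup_def set_mult_def
  by (auto simp: matrix_mul_uminus_left matrix_mul_uminus_right)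

lemma coset_one: "\<one>\<^bsub>PSL2C\<^esub> = {mat 1, - mat 1}"
  by (simp add: PSL2C_def)

lemma coset_inv:
  assumes "det A = 1"
  shows "inv\<^bsub>PSL2C\<^esub> {A, - A} = {adj2 A, - adj2 A}"
proof (rule group.inv_equality[OF group_PSL2C])
  show "{adj2 A, - adj2 A} \<otimes>\<^bsub>PSL2C\<^esub> {A, - A} = \<one>\<^bsub>PSL2C\<^esub>"
    using assms by (simp add: coset_mult coset_one adj2_inverse)
qed (use assms in \<open>auto simp: carrier_PSL2C\<close>)

lemma Union_coset_iff:
  assumes "\<Gamma> \<subseteq> carrier PSL2C" "det A = 1"
  shows "A \<in> \<Union>\<Gamma> \<longleftrightarrow> {A, - A} \<in> \<Gamma>"
proof
  assume "A \<in> \<Union>\<Gamma>"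
  then obtain c where c: "c \<in> \<Gamma>" "A \<in> c" by blast
  then obtain B where "c = {B, - B}" using assms(1) by (auto simp: carrier_PSL2C)
  with c show "{A, - A} \<in> \<Gamma>" by (auto simp: insert_commute)
qed blast

text \<open>Identifies the lines in \<open>\<complex>\<^sup>2\<close> with the points of the Riemann sphere, so that Moebius transformations
  become linear maps.\<close>

definition line_point :: "complex^2 \<Rightarrow> complex option" where
  "line_point v = (if v $ 2 = 0 then None else Some (v $ 1 / v $ 2))"

lemma line_point_eq_iff:
  assumes "v \<noteq> 0" "w \<noteq> 0"
  shows "line_point v = line_point w \<longleftrightarrow> wedge v w = 0"
proof -
  have "v $ 1 \<noteq> 0 \<or> v $ 2 \<noteq> 0" "w $ 1 \<noteq> 0 \<or> w $ 2 \<noteq> 0"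
    using assms by (auto simp: vec_eq_iff forall_2)
  then show ?thesis by (auto simp: line_point_def wedge_def field_simps)
qed

lemma moebius_line_point:
  assumes "det A = 1" "v \<noteq> 0"
  shows "moebius A (line_point v) = line_point (A *v v)"
proof -
  obtain a b c d where A: "A = mat2 a b c d" by (rule mat2_cases)
  show ?thesis
  proof (cases "v $ 2 = 0")
    case True
    then have "v $ 1 \<noteq> 0" using assms(2) by (auto simp: vec_eq_iff forall_2)
    with True show ?thesis
      by (simp add: line_point_def moebius_def A Let_def matrix_vector_mult_def sum_2)
  next
    case False
    then have "c * (v $ 1 / v $ 2) + d = (c * v $ 1 + d * v $ 2) / v $ 2"
      "a * (v $ 1 / v $ 2) + b = (a * v $ 1 + b * v $ 2) / v $ 2" by (simp_all add: field_simps)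
    with False show ?thesis
      by (simp add: line_point_def moebius_def A Let_def matrix_vector_mult_def sum_2)
  qed
qed

lemma discrete_near_one:
  assumes sub: "\<Gamma> \<subseteq> carrier PSL2C" and one: "{mat 1, - mat 1} \<in> \<Gamma>"
    and disc: "subtopology PSL2C_topology \<Gamma> = discrete_topology \<Gamma>"
  shows "\<exists>e>0. \<forall>A\<in>\<Union>\<Gamma>. dist A (mat 1) < e \<longrightarrow> A = mat 1 \<or> A = - mat 1"
proof -
  have "openin (subtopology PSL2C_topology \<Gamma>) {{mat 1, - mat 1}}"
    unfolding disc using one by simp
  then obtain U where U: "openin PSL2C_topology U" "{{mat 1, - mat 1}} = U \<inter> \<Gamma>"
    by (auto simp: openin_subtopology)
  then have op: "openin (top_of_set (carrier SL2C)) (\<Union>U)" and UP: "U \<subseteq> carrier PSL2C"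
    unfolding openin_PSL2C_topology by blast+
  have "mat 1 \<in> \<Union>U" using U(2) by blast
  then obtain e where e: "e > 0" "\<And>A. A \<in> carrier SL2C \<Longrightarrow> dist A (mat 1) < e \<Longrightarrow> A \<in> \<Union>U"
    using op unfolding openin_euclidean_subtopology_iff by blast
  have "A = mat 1 \<or> A = - mat 1" if A: "A \<in> \<Union>\<Gamma>" "dist A (mat 1) < e" for A
  proof -
    have det: "det A = 1" using A(1) sub by (auto simp: carrier_PSL2C det_uminus_2)
    then have "A \<in> \<Union>U" using e(2) A(2) by simp
    then have "{A, - A} \<in> U \<inter> \<Gamma>"
      using Union_coset_iff[OF UP det] Union_coset_iff[OF sub det] A(1) by blast
    then show ?thesis unfolding U(2)[symmetric] by (auto simp: doubleton_eq_iff)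
  qed
  with e(1) show ?thesis by blast
qed

text \<open>Infinitely many elements in a bounded region would accumulate, and quotients of nearby ones would be
  arbitrarily close to the identity.\<close>

lemma discrete_finite_bounded:
  fixes H :: "(complex^2^2) set"
  assumes det: "\<And>A. A \<in> H \<Longrightarrow> det A = 1"
    and mult: "\<And>A B. A \<in> H \<Longrightarrow> B \<in> H \<Longrightarrow> adj2 A ** B \<in> H"
    and e: "e > 0" "\<And>A. A \<in> H \<Longrightarrow> dist A (mat 1) < e \<Longrightarrow> A = mat 1 \<or> A = - mat 1"
    and S: "bounded S"
  shows "finite (H \<inter> S)"
proof (rule ccontr)
  assume inf: "infinite (H \<inter> S)"
  have bd: "bounded (H \<inter> S)" using S by (rule bounded_subset) auto
  obtain f :: "nat \<Rightarrow> complex^2^2" where f: "inj f" "range f \<subseteq> H \<inter> S"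
    using infinite_countable_subset[OF inf] by blast
  obtain l r where r: "strict_mono r" "(f \<circ> r) \<longlonglongrightarrow> l"
    using bounded_imp_convergent_subsequence[of f] bounded_subset[OF bd f(2)] by auto
  define g where "g = f \<circ> r"
  have g: "g \<longlonglongrightarrow> l" "g n \<in> H" "inj g" for n
    using r f by (auto simp: g_def inj_compose strict_mono_imp_inj_on)
  have "det (g n) = 1" for n using g det by blast
  have ent: "(\<lambda>n. g (n + k) $ i $ j) \<longlonglongrightarrow> l $ i $ j" for k i j
    using LIMSEQ_ignore_initial_segment[OF g(1), of k] by (intro tendsto_vec_nth)
  have "(\<lambda>n. det (g n)) \<longlonglongrightarrow> det l"
    unfolding det_2 by (intro tendsto_diff tendsto_mult ent[of 0, unfolded add_0_right])
  then have dl: "det l = 1" using \<open>\<And>n. det (g n) = 1\<close> LIMSEQ_unique by (simp add: LIMSEQ_const_iff)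
  have lim: "(\<lambda>n. adj2 (g n) ** g (n + k)) \<longlonglongrightarrow> mat 1" for k
  proof -
    have "(\<lambda>n. (adj2 (g n) ** g (n + k)) $ i $ j) \<longlonglongrightarrow> (adj2 l ** l) $ i $ j" for i j
    proof -
      have "i = 1 \<or> i = 2" by (rule exhaust_2)
      then show ?thesis
        by (auto simp: matrix_matrix_mult_def adj2_def sum_2
            intro!: tendsto_add tendsto_diff tendsto_mult tendsto_minus ent[of 0, unfolded add_0_right] ent)
    qed
    then have "(\<lambda>n. adj2 (g n) ** g (n + k)) \<longlonglongrightarrow> adj2 l ** l"
      by (intro vec_tendstoI) auto
    then show ?thesis using adj2_inverse(2)[OF dl] by simp
  qed
  have "\<forall>\<^sub>F n in sequentially. dist (adj2 (g n) ** g (n + 1)) (mat 1) < e"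
    "\<forall>\<^sub>F n in sequentially. dist (adj2 (g n) ** g (n + 2)) (mat 1) < e"
    using tendstoD[OF lim e(1)] by blast+
  then have "\<forall>\<^sub>F n in sequentially. dist (adj2 (g n) ** g (n + 1)) (mat 1) < e \<and>
      dist (adj2 (g n) ** g (n + 2)) (mat 1) < e" by (rule eventually_conj)
  then obtain n where n: "dist (adj2 (g n) ** g (n + 1)) (mat 1) < e"
      "dist (adj2 (g n) ** g (n + 2)) (mat 1) < e"
    using eventually_happens'[OF sequentially_bot] by blast
  have *: "g (n + k) = g n \<or> g (n + k) = - g n" if "dist (adj2 (g n) ** g (n + k)) (mat 1) < e" for k
  proof -
    have eq: "g n ** (adj2 (g n) ** g (n + k)) = g (n + k)"
      using adj2_inverse(1)[OF det[OF g(2)[of n]]] by (simp add: matrix_mul_assoc)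
    have "adj2 (g n) ** g (n + k) = mat 1 \<or> adj2 (g n) ** g (n + k) = - mat 1"
      by (rule e(2)[OF mult[OF g(2) g(2)] that])
    then show ?thesis using eq by (auto simp: matrix_mul_uminus_right)
  qed
  \<comment> \<open>three different terms cannot agree up to sign\<close>
  have "g (n + 1) \<noteq> g n" "g (n + 2) \<noteq> g n" "g (n + 1) \<noteq> g (n + 2)"
    using g(3) by (simp_all add: inj_eq)
  then show False using *[OF n(1)] *[OF n(2)] by simp
qed

lemma kleinian_nonelementary_discrete:
  assumes K: "kleinian \<Gamma>" and ne: "\<not> elementary \<Gamma>"
  shows "nonelementary_discrete (\<Union>\<Gamma>)"
proof -
  have sg: "subgroup \<Gamma> PSL2C" and disc: "subtopology PSL2C_topology \<Gamma> = discrete_topology \<Gamma>"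
    using K by (auto simp: kleinian_def)
  have sub: "\<Gamma> \<subseteq> carrier PSL2C" by (rule subgroup.subset[OF sg])
  have det: "det A = 1" if "A \<in> \<Union>\<Gamma>" for A
    using that sub by (auto simp: carrier_PSL2C det_uminus_2)
  have coset: "{A, - A} \<in> \<Gamma>" if "A \<in> \<Union>\<Gamma>" for A
    using that Union_coset_iff[OF sub det[OF that]] by blast
  have rep: "\<exists>A\<in>\<Union>\<Gamma>. \<gamma> = {A, - A}" if \<gamma>: "\<gamma> \<in> \<Gamma>" for \<gamma>
  proof -
    obtain A where "\<gamma> = {A, - A}" using \<gamma> sub by (auto simp: carrier_PSL2C)
    with \<gamma> show ?thesis by blast
  qed
  have one: "{mat 1, - mat 1} \<in> \<Gamma>" using subgroup.one_closed[OF sg] by (simp add: coset_one)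
  have mult: "A ** B \<in> \<Union>\<Gamma>" if "A \<in> \<Union>\<Gamma>" "B \<in> \<Union>\<Gamma>" for A B
    using subgroup.m_closed[OF sg coset[OF that(1)] coset[OF that(2)]] coset_mult[OF det det, OF that]
    by (metis UnionI insertI1)
  have adj: "adj2 A \<in> \<Union>\<Gamma>" if "A \<in> \<Union>\<Gamma>" for A
    using subgroup.m_inv_closed[OF sg coset[OF that]] coset_inv[OF det[OF that]]
    by (metis UnionI insertI1)
  obtain e where e: "e > 0" "\<And>A. A \<in> \<Union>\<Gamma> \<Longrightarrow> dist A (mat 1) < e \<Longrightarrow> A = mat 1 \<or> A = - mat 1"
    using discrete_near_one[OF sub one disc] by blast
  show ?thesis
  proof
    show "det A = 1" if "A \<in> \<Union>\<Gamma>" for A by (rule det[OF that])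
    show "mat 1 \<in> \<Union>\<Gamma>" using one by blast
    show "A ** B \<in> \<Union>\<Gamma>" if "A \<in> \<Union>\<Gamma>" "B \<in> \<Union>\<Gamma>" for A B by (rule mult[OF that])
    show "adj2 A \<in> \<Union>\<Gamma>" if "A \<in> \<Union>\<Gamma>" for A by (rule adj[OF that])
    show "finite (\<Union>\<Gamma> \<inter> S)" if "bounded S" for S
      by (rule discrete_finite_bounded[OF det mult[OF adj] e that])
    show "infinite (\<Union>\<Gamma>)"
    proof
      assume "finite (\<Union>\<Gamma>)"
      then have "finite \<Gamma>" by (rule finite_UnionD)
      moreover have "(0, 1) \<in> H3" by (simp add: H3_def)
      ultimately show False using ne unfolding elementary_def by blast
    qed
    show "\<exists>A\<in>\<Union>\<Gamma>. wedge (A *v v) w \<noteq> 0 \<and> wedge (A *v v) w' \<noteq> 0"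
      if nz: "v \<noteq> 0" "w \<noteq> 0" "w' \<noteq> 0" for v w w'
    proof -
      have "infinite ((\<lambda>\<gamma>. act_sphere \<gamma> (line_point v)) ` \<Gamma>)"
        using ne unfolding elementary_def by blast
      then have "\<not> (\<lambda>\<gamma>. act_sphere \<gamma> (line_point v)) ` \<Gamma> \<subseteq> {line_point w, line_point w'}"
        using finite_subset by blast
      then obtain \<gamma> where \<gamma>: "\<gamma> \<in> \<Gamma>" "act_sphere \<gamma> (line_point v) \<notin> {line_point w, line_point w'}"
        by blast
      obtain A where A: "A \<in> \<Union>\<Gamma>" "\<gamma> = {A, - A}" using rep[OF \<gamma>(1)] by blast
      have dA: "det A = 1" by (rule det[OF A(1)])
      have "A *v v \<noteq> 0"
        using nz(1) adj2_inverse(2)[OF dA]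
        by (metis matrix_vector_mul_assoc matrix_vector_mul_lid matrix_vector_mult_0_right)
      moreover have "line_point (A *v v) \<notin> {line_point w, line_point w'}"
        using \<gamma>(2) moebius_line_point[OF dA nz(1)] by (simp add: A(2))
      ultimately show ?thesis using A(1) nz line_point_eq_iff by blast
    qed
  qed
qed

lemma same_trace_same_length:
  assumes det: "det A = 1" "det B = 1" and tr: "trace A = trace B" "cmod (trace A) > 2"
  shows "loxodromic {A, - A}" "complex_length {A, - A} = complex_length {B, - B}"
proof -
  have lox: "loxodromic {X, - X}" if "det X = 1" "cmod (trace X) > 2" for X
  proof -
    have "(trace X)\<^sup>2 \<notin> of_real ` {0..4}"
    proof
      assume "(trace X)\<^sup>2 \<in> of_real ` {0..4}"
      then have "cmod ((trace X)\<^sup>2) \<le> 4" by auto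
      then have "(cmod (trace X))\<^sup>2 \<le> 2\<^sup>2" by (simp add: norm_power)
      then have "cmod (trace X) \<le> 2" by (rule power2_le_imp_le) simp
      with that show False by simp
    qed
    with that show ?thesis by (auto simp: loxodromic_def carrier_PSL2C)
  qed
  show A: "loxodromic {A, - A}" using lox assms by blast
  have B: "loxodromic {B, - B}" using lox assms by simp
  have "complex_length {A, - A} = L \<longleftrightarrow> complex_length {B, - B} = L" for L
    unfolding complex_length_eq_iff[OF A] complex_length_eq_iff[OF B] by (simp add: tr)
  then show "complex_length {A, - A} = complex_length {B, - B}" by blast
qed

text \<open>Matrices that represent conjugate elements of PSL(2,C) are conjugate up to sign only.\<close>

lemma conj_class_eq_imp:
  assumes sub: "\<Gamma> \<subseteq> carrier PSL2C" and one: "{mat 1, - mat 1} \<in> \<Gamma>"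
    and A: "det A = 1" and B: "det B = 1"
    and eq: "conj_class \<Gamma> {A, - A} = conj_class \<Gamma> {B, - B}"
  shows "\<exists>h\<in>\<Union>\<Gamma>. h ** A = B ** h \<or> h ** A = - (B ** h)"
proof -
  have conj: "{h, - h} \<otimes>\<^bsub>PSL2C\<^esub> {X, - X} \<otimes>\<^bsub>PSL2C\<^esub> inv\<^bsub>PSL2C\<^esub> {h, - h} = {h ** X ** adj2 h, - (h ** X ** adj2 h)}"
    if "det h = 1" "det X = 1" for h X
    using that by (simp add: coset_inv coset_mult det_mul)
  have "{B, - B} \<in> conj_class \<Gamma> {B, - B}"
    unfolding conj_class_def
  proof (rule image_eqI[OF _ one])
    show "{B, - B} = {mat 1, - mat 1} \<otimes>\<^bsub>PSL2C\<^esub> {B, - B} \<otimes>\<^bsub>PSL2C\<^esub> inv\<^bsub>PSL2C\<^esub> {mat 1, - mat 1}"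
      using adj2_inverse(2)[of "mat 1 :: complex^2^2"] by (simp add: conj B)
  qed
  then have "{B, - B} \<in> conj_class \<Gamma> {A, - A}" by (simp only: eq)
  then obtain \<eta> where \<eta>: "\<eta> \<in> \<Gamma>"
    "{B, - B} = \<eta> \<otimes>\<^bsub>PSL2C\<^esub> {A, - A} \<otimes>\<^bsub>PSL2C\<^esub> inv\<^bsub>PSL2C\<^esub> \<eta>"
    unfolding conj_class_def by blast
  then obtain h where h: "\<eta> = {h, - h}" "det h = 1" using sub by (auto simp: carrier_PSL2C)
  have "{B, - B} = {h ** A ** adj2 h, - (h ** A ** adj2 h)}"
    using \<eta>(2) unfolding h(1) conj[OF h(2) A] .
  then have "B = h ** A ** adj2 h \<or> B = - (h ** A ** adj2 h)" by (auto simp: doubleton_eq_iff)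
  moreover have "h ** A ** adj2 h ** h = h ** A"
    using adj2_inverse(2)[OF h(2)] by (simp flip: matrix_mul_assoc)
  ultimately have "B ** h = h ** A \<or> B ** h = - (h ** A)" by (auto simp: matrix_mul_uminus_left)
  then show ?thesis using \<eta>(1) h(1) by (intro bexI[of _ h]) auto
qed

section \<open>Unbounded multiplicity\<close>

theorem theorem1p2:
  fixes \<Gamma> :: "(complex^2^2) set set"
  assumes "kleinian \<Gamma>" and "fin_gen \<Gamma>" and "\<not> elementary \<Gamma>"
  shows "\<forall>n::nat. n > 0 \<longrightarrow>
    (\<exists>L. \<exists>C \<subseteq> classes_of_length \<Gamma> L. finite C \<and> card C \<ge> n)"
proof (intro allI impI)
  fix n :: nat
  interpret nonelementary_discrete "\<Union>\<Gamma>"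
    using kleinian_nonelementary_discrete[OF assms(1,3)] .
  have sg: "subgroup \<Gamma> PSL2C" using assms(1) by (simp add: kleinian_def)
  have sub: "\<Gamma> \<subseteq> carrier PSL2C" by (rule subgroup.subset[OF sg])
  have one: "{mat 1, - mat 1} \<in> \<Gamma>" using subgroup.one_closed[OF sg] by (simp add: coset_one)
  obtain W t where W: "finite W" "card W = Suc n" "W \<subseteq> \<Union>\<Gamma>" "cmod t > 2" "\<forall>A\<in>W. trace A = t"
    and nonconj: "\<forall>A\<in>W. \<forall>B\<in>W. A \<noteq> B \<longrightarrow> (\<forall>h\<in>\<Union>\<Gamma>. h ** A \<noteq> B ** h \<and> h ** A \<noteq> - (B ** h))"
    using many_nonconjugate[of n] by (elim exE conjE) (rule that)
  have det: "det A = 1" if "A \<in> W" for A using that W(3) det_H by blast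
  obtain A0 where A0: "A0 \<in> W" using W(2) by (metis card.empty ex_in_conv nat.distinct(1))
  define c where "c A = conj_class \<Gamma> {A, - A}" for A
  define L where "L = complex_length {A0, - A0}"
  have "c A \<in> classes_of_length \<Gamma> L" if A: "A \<in> W" for A
  proof -
    have "trace A = trace A0" "cmod (trace A) > 2" using W(4,5) A A0 by auto
    note len = same_trace_same_length[OF det[OF A] det[OF A0] this]
    have "{A, - A} \<in> \<Gamma>" using Union_coset_iff[OF sub det[OF A]] A W(3) by blast
    then show ?thesis unfolding classes_of_length_def c_def L_def using len by blast
  qed
  then have "c ` W \<subseteq> classes_of_length \<Gamma> L" by blast
  moreover have "inj_on c W"
  proof (rule inj_onI, rule ccontr)
    fix A B assume AB: "A \<in> W" "B \<in> W" "c A = c B" "A \<noteq> B"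
    then show False
      using conj_class_eq_imp[OF sub one det det, of A B] nonconj unfolding c_def by blast
  qed
  then have "card (c ` W) \<ge> n" using W(2) by (simp add: card_image)
  moreover have "finite (c ` W)" using W(1) by simp
  ultimately show "\<exists>L. \<exists>C \<subseteq> classes_of_length \<Gamma> L. finite C \<and> card C \<ge> n" by blast
qed

end
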